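(* Let $p\in\{1,2,3,\ldots\}$ and consider the equation $$t\frac{\partial u}{\partial t}=\alpha(t,x)+\lambda(t,x)u+(\beta(t,x)+x^pc(t,x))\Bigl(x\frac{\partial u}{\partial x}\Bigr)+R_2\Bigl(t,x,u,x\frac{\partial u}{\partial x}\Bigr)\qquad(\mathrm{E})$$ where $\alpha,\lambda,\beta,c$ are continuous functions on $[0,T_0]\times D_{R_0}$, holomorphic in $x$ for each fixed $t$, and $R_2(t,x,u,v)$ is a continuous function on $\Omega=[0,T_0]\times D_{R_0}\times D_{\rho_0}\times D_{\rho_0}$, holomorphic in $(x,u,v)$ for each fixed $t$, with a Taylor expansion in $(u,v)$ of the form $R_2(t,x,u,v)=\sum_{i+j\ge2}a_{i,j}(t,x)u^iv^j$. Let $\mu(t)$ be a weight function on $(0,T_0]$ and suppose that $$\sup_{x\in D_{R_0}}|\alpha(t,x)|=O(\mu(t)),\qquad \sup_{x\in D_{R_0}}|\beta(t,x)|=O(\mu(t))\qquad(\text{as }t\to+0),$$ that $c(0,0)<0$ (i.e. $c(0,0)$ is a negative real number), and that $\mathrm{Re}\,\lambda(0,0)<0$. Let $u_0(t,x)$ be the solution of $(\mathrm{E})$ described in the context. Let $u(t,x)\in\mathscr{X}_1((0,T)\times S(\theta,R))$ be a solution of $(\mathrm{E})$ with $T>0$, $\theta>0$ and $R>0$. If $$\varlimsup_{\eta\to+0}\Bigl[\lim_{\sigma\to+0}\Bigl(\frac{1}{\eta^2}\sup_{(0,\sigma)\times S(\eta\theta,\eta R)}|u(t,x)|\Bigr)\Bigr]=0,$$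 then $u(t,x)=u_0(t,x)$ on $(0,T_1)\times S(\theta_1,R_1)$ for some $T_1>0$, $\theta_1>0$ and $R_1>0$.
   Context: Here $t\in\mathbb{R}$ and $x,u,v\in\mathbb{C}$; $D_r=\{z\in\mathbb{C}: |z|<r\}$; $T_0,R_0,\rho_0>0$ are given. A weight function on $(0,T_0]$ is a positive-valued continuous function $\mu$ on $(0,T_0]$, increasing in $t$, with $\int_0^{T_0}\frac{\mu(s)}{s}ds<\infty$. Set $\varphi(t)=\int_0^t\frac{\mu(s)}{s}ds$. For $\theta>0$, $R>0$: $S(\theta,R)=\{x\in\mathbb{C}: 0<|x|<R,\ |\arg x|<\theta\}$ (principal argument). $\mathscr{X}_1((0,T)\times S(\theta,R))$ is the set of $C^1$ functions on $(0,T)\times S(\theta,R)$ that are holomorphic in $x$ for each fixed $t$. A solution $u$ in this space is understood to be such that $(t,x,u(t,x),x\,\partial u/\partial x(t,x))\in\Omega$ and $(\mathrm{E})$ holds at all points of $(0,T)\times S(\theta,R)$. For $T>0$, $R>0$, $0<\theta<\pi/2p$, $r>0$, with $S=S(\theta,R)$, set $d_S(x)=\min\{\log(R/|x|),\theta-|\arg x|\}$ and $W_{T,R,\theta,r}=\{(t,x)\in(0,T)\times S: \varphi(t)/r<d_S(x)\}$; $\mathscr{X}_1(W_{T,R,\theta,r})$ is the set of $C^1$ functions on $W_{T,R,\theta,r}$ that are holomorphic in $x$ for each fixed $t$. The solution $u_0$: it is known (Bacani-Tahara) that under the stated hypotheses on the coefficients (including $c(0,0)<0$ and $\mathrm{Re}\,\lambda(0,0)<0$)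 there are $T^*>0$, $R^*>0$, $0<\theta^*<\pi/2p$, $r^*>0$ such that $(\mathrm{E})$ has a unique solution $u_0\in\mathscr{X}_1(W_{T^*,R^*,\theta^*,r^*})$ satisfying $|u_0(t,x)|\le M\mu(t)$ and $|x\frac{\partial u_0}{\partial x}(t,x)|\le M\mu(t)$ on $W_{T^*,R^*,\theta^*,r^*}$ for some $M>0$. Fix such $T^*,R^*,\theta^*,r^*$ and this $u_0$. *)

theory Defs
  imports "HOL-Analysis.Analysis"
begin

text \<open>Functions of \<open>(t, x)\<close> are curried, \<open>real \<Rightarrow> complex \<Rightarrow> complex\<close>; only their values on the
  stated domains matter.\<close>

text \<open>``Increasing'' is read in the weak sense.\<close>

definition weight_function :: "real \<Rightarrow> (real \<Rightarrow> real) \<Rightarrow> bool" where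
  "weight_function T0 \<mu> \<longleftrightarrow>
     continuous_on {0<..T0} \<mu> \<and>
     (\<forall>t\<in>{0<..T0}. 0 < \<mu> t) \<and>
     mono_on {0<..T0} \<mu> \<and>
     set_integrable lborel {0<..T0} (\<lambda>s. \<mu> s / s)"

definition weight_primitive :: "(real \<Rightarrow> real) \<Rightarrow> real \<Rightarrow> real" where
  "weight_primitive \<mu> t = (LINT s:{0<..t}|lborel. \<mu> s / s)"

definition sector :: "real \<Rightarrow> real \<Rightarrow> complex set" where
  "sector \<theta> R = {x. 0 < norm x \<and> norm x < R \<and> \<bar>Arg x\<bar> < \<theta>}"

definition sector_dist :: "real \<Rightarrow> real \<Rightarrow> complex \<Rightarrow> real" where
  "sector_dist \<theta> R x = min (ln (R / norm x)) (\<theta> - \<bar>Arg x\<bar>)"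

definition W_domain ::
    "(real \<Rightarrow> real) \<Rightarrow> real \<Rightarrow> real \<Rightarrow> real \<Rightarrow> real \<Rightarrow> (real \<times> complex) set" where
  "W_domain \<mu> T R \<theta> r =
     {(t, x). (t, x) \<in> {0<..<T} \<times> sector \<theta> R \<and> weight_primitive \<mu> t / r < sector_dist \<theta> R x}"

text \<open>Continuous real differentiability, for open sets \<open>W\<close>.\<close>

definition C1_on :: "(real \<times> complex \<Rightarrow> complex) \<Rightarrow> (real \<times> complex) set \<Rightarrow> bool" where
  "C1_on f W \<longleftrightarrow>
     (\<exists>f' :: real \<times> complex \<Rightarrow> (real \<times> complex) \<Rightarrow>\<^sub>L complex.
        (\<forall>z\<in>W. (f has_derivative blinfun_apply (f' z)) (at z)) \<and> continuous_on W f')"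

definition X1 :: "(real \<times> complex) set \<Rightarrow> (real \<Rightarrow> complex \<Rightarrow> complex) set" where
  "X1 W = {u. C1_on (\<lambda>(t, x). u t x) W \<and> (\<forall>t. u t holomorphic_on {x. (t, x) \<in> W})}"

definition Omega :: "real \<Rightarrow> real \<Rightarrow> real \<Rightarrow> (real \<times> complex \<times> complex \<times> complex) set" where
  "Omega T0 R0 \<rho>0 = {0..T0} \<times> ball 0 R0 \<times> ball 0 \<rho>0 \<times> ball 0 \<rho>0"

text \<open>Joint holomorphy in three complex variables on an open set: at each point there is a
  Frechet derivative, and it is complex linear.\<close>

definition holomorphic3_on ::
    "(complex \<times> complex \<times> complex \<Rightarrow> complex) \<Rightarrow> (complex \<times> complex \<times> complex) set \<Rightarrow> bool" where
  "holomorphic3_on f U \<longleftrightarrow>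
     (\<forall>z\<in>U. \<exists>a b c. (f has_derivative (\<lambda>(h, k, l). a * h + b * k + c * l)) (at z))"

definition coefficient_function ::
    "real \<Rightarrow> real \<Rightarrow> (real \<Rightarrow> complex \<Rightarrow> complex) \<Rightarrow> bool" where
  "coefficient_function T0 R0 f \<longleftrightarrow>
     continuous_on ({0..T0} \<times> ball 0 R0) (\<lambda>(t, x). f t x) \<and>
     (\<forall>t\<in>{0..T0}. f t holomorphic_on ball 0 R0)"

definition remainder_function ::
    "real \<Rightarrow> real \<Rightarrow> real \<Rightarrow> (real \<Rightarrow> complex \<Rightarrow> complex \<Rightarrow> complex \<Rightarrow> complex) \<Rightarrow> bool" where
  "remainder_function T0 R0 \<rho>0 R2 \<longleftrightarrow>
     continuous_on (Omega T0 R0 \<rho>0) (\<lambda>(t, x, u, v). R2 t x u v) \<and>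
     (\<forall>t\<in>{0..T0}.
        holomorphic3_on (\<lambda>(x, u, v). R2 t x u v) (ball 0 R0 \<times> ball 0 \<rho>0 \<times> ball 0 \<rho>0)) \<and>
     (\<exists>a :: nat \<Rightarrow> nat \<Rightarrow> real \<Rightarrow> complex \<Rightarrow> complex.
        \<forall>(t, x, u, v)\<in>Omega T0 R0 \<rho>0.
          ((\<lambda>(i, j). a i j t x * u ^ i * v ^ j) has_sum R2 t x u v) {(i, j). i + j \<ge> 2})"

text \<open>The supremum is taken in the extended reals, since it may be infinite for some \<open>t\<close>.\<close>

definition sup_bigo :: "real \<Rightarrow> (real \<Rightarrow> complex \<Rightarrow> complex) \<Rightarrow> (real \<Rightarrow> real) \<Rightarrow> bool" where
  "sup_bigo R0 f \<mu> \<longleftrightarrow>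
     (\<exists>C::real. \<forall>\<^sub>F t in at_right 0. (SUP x\<in>ball 0 R0. ereal (norm (f t x))) \<le> ereal (C * \<mu> t))"

text \<open>\<open>u\<close> solves
  \<open>t \<partial>\<^sub>t u = \<alpha> + \<lambda> u + (\<beta> + x\<^sup>p c) (x \<partial>\<^sub>x u) + R2(t, x, u, x \<partial>\<^sub>x u)\<close> at all points of \<open>W\<close>;
  here \<open>\<lambda>\<close> is called \<open>lam\<close>.\<close>

definition solves_E ::
    "real \<Rightarrow> real \<Rightarrow> real \<Rightarrow> nat \<Rightarrow>
     (real \<Rightarrow> complex \<Rightarrow> complex) \<Rightarrow> (real \<Rightarrow> complex \<Rightarrow> complex) \<Rightarrow>
     (real \<Rightarrow> complex \<Rightarrow> complex) \<Rightarrow> (real \<Rightarrow> complex \<Rightarrow> complex) \<Rightarrow>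
     (real \<Rightarrow> complex \<Rightarrow> complex \<Rightarrow> complex \<Rightarrow> complex) \<Rightarrow>
     (real \<times> complex) set \<Rightarrow> (real \<Rightarrow> complex \<Rightarrow> complex) \<Rightarrow> bool" where
  "solves_E T0 R0 \<rho>0 p \<alpha> lam \<beta> c R2 W u \<longleftrightarrow>
     (\<forall>(t, x)\<in>W.
        (t, x, u t x, x * deriv (u t) x) \<in> Omega T0 R0 \<rho>0 \<and>
        of_real t * vector_derivative (\<lambda>s. u s x) (at t) =
          \<alpha> t x + lam t x * u t x + (\<beta> t x + x ^ p * c t x) * (x * deriv (u t) x)
          + R2 t x (u t x) (x * deriv (u t) x))"

definition mu_bounded ::
    "(real \<Rightarrow> real) \<Rightarrow> (real \<times> complex) set \<Rightarrow> (real \<Rightarrow> complex \<Rightarrow> complex) \<Rightarrow> bool" where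
  "mu_bounded \<mu> W u \<longleftrightarrow>
     (\<exists>M>0. \<forall>(t, x)\<in>W. norm (u t x) \<le> M * \<mu> t \<and> norm (x * deriv (u t) x) \<le> M * \<mu> t)"

definition unique_bounded_solution ::
    "real \<Rightarrow> real \<Rightarrow> real \<Rightarrow> nat \<Rightarrow>
     (real \<Rightarrow> complex \<Rightarrow> complex) \<Rightarrow> (real \<Rightarrow> complex \<Rightarrow> complex) \<Rightarrow>
     (real \<Rightarrow> complex \<Rightarrow> complex) \<Rightarrow> (real \<Rightarrow> complex \<Rightarrow> complex) \<Rightarrow>
     (real \<Rightarrow> complex \<Rightarrow> complex \<Rightarrow> complex \<Rightarrow> complex) \<Rightarrow>
     (real \<Rightarrow> real) \<Rightarrow> (real \<times> complex) set \<Rightarrow> (real \<Rightarrow> complex \<Rightarrow> complex) \<Rightarrow> bool" where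
  "unique_bounded_solution T0 R0 \<rho>0 p \<alpha> lam \<beta> c R2 \<mu> W u0 \<longleftrightarrow>
     (let sol = (\<lambda>w. w \<in> X1 W \<and> solves_E T0 R0 \<rho>0 p \<alpha> lam \<beta> c R2 W w \<and> mu_bounded \<mu> W w)
      in sol u0 \<and> (\<forall>w. sol w \<longrightarrow> (\<forall>(t, x)\<in>W. w t x = u0 t x)))"

end

theory Submission
  imports Defs "HOL-Complex_Analysis.Complex_Analysis"
begin

text \<open>In the variables \<open>\<tau> = ln t\<close>, \<open>y = ln x\<close> the difference \<open>W\<close> of the two solutions satisfies a linear
  transport equation \<open>W\<^sub>\<tau> = A W + b W\<^sub>y\<close> with \<open>Re A \<le> - 2 a0 < 0\<close>, where \<open>b\<close> is \<open>\<beta> + x\<^sup>p c\<close> plus a term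
  bounded by a constant times \<open>|W| + |W\<^sub>y| + \<mu>\<close>. Backwards in time, \<open>x\<^sup>p c\<close> points into a narrow
  sector, the \<open>\<mu>\<close>-part of the drift is integrable in \<open>\<tau>\<close>, and \<open>W\<^sub>y\<close> is controlled by Cauchy's
  inequality at the price of shrinking the domain. If \<open>|W| \<le> \<nu>\<^sup>2\<close>, then shrinking the domain by a
  multiple of \<open>\<nu>\<close> and going back one unit of \<open>\<tau>\<close> improves the bound by the factor \<open>exp (- a0)\<close>,
  uniformly in \<open>\<tau>\<close>. Iterating, the total loss of domain is a geometric series of size \<open>O(\<nu>)\<close>, which
  fits into a sector of opening \<open>\<eta> \<theta>\<close> exactly because the initial bound is \<open>o(\<eta>\<^sup>2)\<close>; hence
  \<open>W = 0\<close>. No characteristics are integrated: a maximum principle replaces them.\<close>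

section \<open>Transport inequalities on shrinking half strips\<close>

text \<open>At an interior-time maximum of \<open>|W| exp (a0 \<tau> + s Re y)\<close> the point \<open>(\<tau> - e, y + e b)\<close> still lies in
  \<open>K\<close> for small \<open>e > 0\<close>, while the weighted modulus strictly increases in this direction. The factor
  \<open>exp (s Re y)\<close> restores compactness as \<open>Re y\<close> tends to minus infinity; afterwards \<open>s\<close> tends to \<open>0\<close>.\<close>

lemma transport_max_principle:
  fixes W :: "real \<Rightarrow> complex \<Rightarrow> complex" and g g' :: "real \<Rightarrow> real" and \<tau>0 \<tau>1 L \<Theta> a0 bm N :: real
  defines "K \<equiv> {(\<tau>, y). \<tau>0 \<le> \<tau> \<and> \<tau> \<le> \<tau>1 \<and> Re y \<le> L - g \<tau> \<and> \<bar>Im y\<bar> \<le> \<Theta> - g \<tau>}"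
  assumes a0: "a0 > 0" and bm: "bm > 0" and N: "N \<ge> 0"
    and g_nonneg: "\<And>\<tau>. \<tau> \<in> {\<tau>0..\<tau>1} \<Longrightarrow> 0 \<le> g \<tau>"
    and g_deriv: "\<And>\<tau>. \<tau> \<in> {\<tau>0..\<tau>1} \<Longrightarrow> (g has_real_derivative g' \<tau>) (at \<tau>)"
    and cont: "continuous_on K (\<lambda>(\<tau>, y). W \<tau> y)"
    and bound: "\<And>\<tau> y. (\<tau>, y) \<in> K \<Longrightarrow> norm (W \<tau> y) \<le> N"
    and transport: "\<And>\<tau> y. (\<tau>, y) \<in> K \<Longrightarrow> \<tau>0 < \<tau> \<Longrightarrow> \<exists>A b.
       ((\<lambda>e. W (\<tau> - e) (y + of_real e * b)) has_vector_derivative (- A * W \<tau> y)) (at 0) \<and>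
       Re A \<le> - 2 * a0 \<and> norm b \<le> bm \<and> Re b < g' \<tau> \<and>
       (Im y = \<Theta> - g \<tau> \<longrightarrow> Im b < g' \<tau>) \<and> (- Im y = \<Theta> - g \<tau> \<longrightarrow> - Im b < g' \<tau>)"
    and y1: "(\<tau>1, y1) \<in> K"
  shows "norm (W \<tau>1 y1) \<le> exp (- a0 * (\<tau>1 - \<tau>0)) * N"
proof -
  \<comment> \<open>One \<open>a0\<close> out of the decay rate \<open>2 * a0\<close> pays for the
    factor \<open>exp (a0 * (\<tau> - \<tau>0))\<close>. The condition \<open>s * bm < a0\<close>
    keeps the contribution \<open>s * Re b\<close> of the spatial weight below the remaining
    \<open>a0\<close>.\<close>
  have weighted: "norm (W \<tau>1 y1 * exp (of_real (a0 * (\<tau>1 - \<tau>0)) + of_real s * y1)) \<le> N * exp (s * L)"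
    if s: "s > 0" "s * bm < a0" for s
  proof (rule ccontr)
    define Z where "Z = (\<lambda>\<tau> y. W \<tau> y * exp (of_real (a0 * (\<tau> - \<tau>0)) + of_real s * y))"
    assume "\<not> ?thesis"
    then have big: "norm (Z \<tau>1 y1) > N * exp (s * L)" by (simp add: Z_def)
    define z1 where "z1 = norm (Z \<tau>1 y1)"
    have z1: "z1 > 0"
      using big N mult_nonneg_nonneg[OF N exp_ge_zero[of "s * L"]] unfolding z1_def by linarith
    have normZ: "norm (Z \<tau> y) = norm (W \<tau> y) * exp (a0 * (\<tau> - \<tau>0) + s * Re y)" for \<tau> y
      by (simp add: Z_def norm_mult)
    have contZ: "continuous_on K (\<lambda>(\<tau>, y). Z \<tau> y)"
      using cont unfolding Z_def case_prod_unfold by (intro continuous_intros)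
    \<comment> \<open>To the left of \<open>\<Lambda>\<close> the factor
      \<open>exp (s * Re y)\<close> pushes the weighted modulus below its value \<open>z1\<close> at
      the end point, so a maximum can only lie in the compact part \<open>K'\<close>. Dividing by
      \<open>N + 1\<close> covers the case \<open>N = 0\<close>.\<close>
    define \<Lambda> where "\<Lambda> = (ln (z1 / (N + 1)) - a0 * (\<tau>1 - \<tau>0)) / s"
    define K' where "K' = {z \<in> K. Re (snd z) \<ge> \<Lambda>}"
    have far: "norm (Z \<tau> y) < z1" if "(\<tau>, y) \<in> K" "Re y < \<Lambda>" for \<tau> y
    proof -
      have "s * Re y < ln (z1 / (N + 1)) - a0 * (\<tau>1 - \<tau>0)"
        using that(2) s(1) by (simp add: \<Lambda>_def field_simps)
      moreover have "a0 * (\<tau> - \<tau>0) \<le> a0 * (\<tau>1 - \<tau>0)"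
        using that(1) a0 by (simp add: K_def)
      ultimately have "a0 * (\<tau> - \<tau>0) + s * Re y < ln (z1 / (N + 1))" by linarith
      then have "exp (a0 * (\<tau> - \<tau>0) + s * Re y) < z1 / (N + 1)"
        using z1 N by (metis add_nonneg_pos divide_pos_pos exp_less_mono exp_ln zero_less_one)
      then have "(N + 1) * exp (a0 * (\<tau> - \<tau>0) + s * Re y) < z1"
        using N by (simp add: field_simps)
      moreover have "norm (W \<tau> y) * exp (a0 * (\<tau> - \<tau>0) + s * Re y) \<le> (N + 1) * exp (a0 * (\<tau> - \<tau>0) + s * Re y)"
        using bound[OF that(1)] by (intro mult_right_mono) auto
      ultimately show ?thesis unfolding normZ by linarith
    qed
    have gc: "continuous_on {\<tau>0..\<tau>1} g"
      using g_deriv by (meson DERIV_isCont continuous_at_imp_continuous_on)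
    have K'_eq: "K' = {z \<in> {z \<in> {\<tau>0..\<tau>1} \<times> UNIV. Re (snd z) \<le> L - g (fst z)}. \<bar>Im (snd z)\<bar> \<le> \<Theta> - g (fst z)}
                  \<inter> {z. \<Lambda> \<le> Re (snd z)}"
      by (auto simp: K'_def K_def)
    have gc': "continuous_on ({\<tau>0..\<tau>1} \<times> (UNIV :: complex set)) (\<lambda>z. g (fst z))"
      by (rule continuous_on_compose2[OF gc]) (auto intro: continuous_intros)
    have "closed {z \<in> {\<tau>0..\<tau>1} \<times> UNIV. Re (snd z) \<le> L - g (fst z)}"
      by (intro continuous_on_closed_Collect_le closed_Times continuous_intros gc')
    then have "closed K'"
      unfolding K'_eq
      by (intro closed_Int closed_Collect_le continuous_on_closed_Collect_le continuous_intros
          continuous_on_subset[OF gc'] closed_Times closed_UNIV closed_atLeastAtMost) auto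
    moreover have "bounded K'"
    proof (rule bounded_subset)
      show "bounded ({\<tau>0..\<tau>1} \<times> cbox (Complex \<Lambda> (- \<Theta>)) (Complex L \<Theta>))"
        by (intro bounded_Times bounded_closed_interval bounded_cbox)
      show "K' \<subseteq> {\<tau>0..\<tau>1} \<times> cbox (Complex \<Lambda> (- \<Theta>)) (Complex L \<Theta>)"
        using g_nonneg by (force simp: K'_def K_def in_cbox_complex_iff)
    qed
    ultimately have "compact K'" by (simp add: compact_eq_bounded_closed)
    moreover have "(\<tau>1, y1) \<in> K'"
      using far[OF y1] y1 by (force simp: K'_def z1_def)
    moreover have "continuous_on K' (\<lambda>z. norm (case z of (\<tau>, y) \<Rightarrow> Z \<tau> y))"
      using contZ by (intro continuous_on_norm) (auto intro: continuous_on_subset simp: K'_def)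
    ultimately obtain zm where zm: "zm \<in> K'" "\<And>z. z \<in> K' \<Longrightarrow> norm (case z of (\<tau>, y) \<Rightarrow> Z \<tau> y) \<le> norm (case zm of (\<tau>, y) \<Rightarrow> Z \<tau> y)"
      using continuous_attains_sup[of K'] by (metis empty_iff)
    obtain \<tau> y where ty: "zm = (\<tau>, y)" by force
    have z1_le: "z1 \<le> norm (Z \<tau> y)"
      using zm(2)[OF \<open>(\<tau>1, y1) \<in> K'\<close>] by (simp add: ty z1_def)
    have inK: "(\<tau>, y) \<in> K" using zm ty by (simp add: K'_def)
    have max: "norm (Z \<tau>' y') \<le> norm (Z \<tau> y)" if "(\<tau>', y') \<in> K" for \<tau>' y'
      using zm(2)[of "(\<tau>', y')"] far[OF that] z1_le that by (force simp: ty K'_def)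
    \<comment> \<open>At the initial time the weight is at most \<open>exp (s * L)\<close> because
      \<open>g\<close> is nonnegative, so the bound \<open>N\<close> excludes a value as large as
      \<open>z1\<close>.\<close>
    have "\<tau>0 < \<tau>"
    proof (rule ccontr)
      assume "\<not> \<tau>0 < \<tau>"
      then have t0: "\<tau> = \<tau>0" using inK by (simp add: K_def)
      have "Re y \<le> L" using inK g_nonneg[of \<tau>] by (simp add: K_def)
      then have "norm (Z \<tau> y) \<le> N * exp (s * L)"
        unfolding normZ t0 using bound[OF inK] N s by (intro mult_mono) (auto simp: t0)
      with z1_le big show False by (simp add: z1_def)
    qed
    from transport[OF inK this] obtain A b where Ab:
       "((\<lambda>e. W (\<tau> - e) (y + of_real e * b)) has_vector_derivative (- A * W \<tau> y)) (at 0)"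
       "Re A \<le> - 2 * a0" "norm b \<le> bm" "Re b < g' \<tau>"
       "Im y = \<Theta> - g \<tau> \<Longrightarrow> Im b < g' \<tau>" "- Im y = \<Theta> - g \<tau> \<Longrightarrow> - Im b < g' \<tau>"
      by blast
    define E where "E = (\<lambda>e::real. exp (of_real (a0 * (\<tau> - e - \<tau>0)) + of_real s * (y + of_real e * b)))"
    define \<zeta> where "\<zeta> = (\<lambda>e. Z (\<tau> - e) (y + of_real e * b))"
    have \<zeta>_eq: "\<zeta> = (\<lambda>e. W (\<tau> - e) (y + of_real e * b) * E e)"
      by (simp add: \<zeta>_def Z_def E_def)
    have dE: "(E has_vector_derivative E 0 * (of_real s * b - of_real a0)) (at 0)"
    proof -
      have "((\<lambda>e::real. of_real (a0 * (\<tau> - e - \<tau>0)) + of_real s * (y + of_real e * b))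
          has_vector_derivative (of_real s * b - of_real a0)) (at 0)"
        unfolding has_vector_derivative_def
        by (auto intro!: derivative_eq_intros simp: fun_eq_iff scaleR_conv_of_real algebra_simps)
      from field_vector_diff_chain_at[OF this DERIV_exp] show ?thesis
        by (simp add: o_def E_def mult.commute)
    qed
    have d\<zeta>: "(\<zeta> has_vector_derivative \<zeta> 0 * (- A - of_real a0 + of_real s * b)) (at 0)"
      unfolding \<zeta>_eq
      by (rule has_vector_derivative_eq_rhs, rule has_vector_derivative_mult[OF Ab(1) dE])
         (simp add: algebra_simps)
    \<comment> \<open>Differentiating the squared modulus isolates the real part
      \<open>- Re A - a0 + s * Re b\<close> of the logarithmic derivative, which is positive by the
      choice of \<open>s\<close>.\<close>
    have dn: "((\<lambda>e. \<zeta> e \<bullet> \<zeta> e) has_real_derivative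
        2 * (\<zeta> 0 \<bullet> (\<zeta> 0 * (- A - of_real a0 + of_real s * b)))) (at 0)"
      using d\<zeta> unfolding has_vector_derivative_def has_field_derivative_def
      by (auto intro!: derivative_eq_intros simp: inner_commute)
    have inner: "\<zeta> 0 \<bullet> (\<zeta> 0 * (- A - of_real a0 + of_real s * b)) = (norm (\<zeta> 0))\<^sup>2 * (- Re A - a0 + s * Re b)"
      unfolding cmod_power2 by (simp add: inner_complex_def power2_eq_square algebra_simps)
    have \<zeta>_pos: "norm (\<zeta> 0) > 0" using less_le_trans[OF z1 z1_le] by (simp add: \<zeta>_def)
    have rate: "- Re A - a0 + s * Re b > 0"
    proof -
      have "\<bar>Re b\<bar> \<le> bm" using Ab(3) abs_Re_le_cmod[of b] by linarith
      then have "s * \<bar>Re b\<bar> \<le> s * bm" using s by simp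
      then have "- (s * Re b) < a0" using s by (smt (verit) mult_minus_right mult_left_mono)
      then show ?thesis using Ab(2) by linarith
    qed
    have "2 * (\<zeta> 0 \<bullet> (\<zeta> 0 * (- A - of_real a0 + of_real s * b))) > 0"
      unfolding inner using \<zeta>_pos rate by (intro mult_pos_pos zero_less_power) auto
    from DERIV_pos_inc_right[OF dn this]
    obtain d where d: "d > 0" "\<And>h. 0 < h \<Longrightarrow> h < d \<Longrightarrow> \<zeta> 0 \<bullet> \<zeta> 0 < \<zeta> h \<bullet> \<zeta> h" by auto
    have inc: "\<forall>\<^sub>F e in at_right 0. norm (\<zeta> 0) < norm (\<zeta> e)"
      unfolding eventually_at_right_field using d by (auto intro!: exI[of _ d] simp: norm_eq_sqrt_inner)
    have \<tau>_in: "\<tau> \<in> {\<tau>0..\<tau>1}" using inK by (simp add: K_def)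
    \<comment> \<open>Every spatial constraint of \<open>K\<close> has the form
      \<open>v + g \<tau> \<le> B\<close>. An inactive one persists by continuity; an active one
      persists because \<open>w < g' \<tau>\<close> makes its left side strictly decrease. This is
      why the hypotheses on \<open>Im b\<close> are asked for only on the lateral boundary.\<close>
    have side: "\<forall>\<^sub>F e in at_right (0::real). v + e * w + g (\<tau> - e) \<le> B"
      if "v + g \<tau> \<le> B" "v + g \<tau> = B \<Longrightarrow> w < g' \<tau>" for v w B
    proof -
      have gd: "((\<lambda>e. g (\<tau> - e)) has_real_derivative - g' \<tau>) (at 0)"
      proof -
        have "((\<lambda>e. \<tau> - e) has_real_derivative -1) (at 0)" by (auto intro!: derivative_eq_intros)
        with DERIV_chain2[of g "g' \<tau>" "\<lambda>e. \<tau> - e" 0 "-1"] g_deriv[OF \<tau>_in] show ?thesis by simp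
      qed
      have dd: "((\<lambda>e. v + e * w + g (\<tau> - e)) has_real_derivative (w - g' \<tau>)) (at 0)"
        by (auto intro!: derivative_eq_intros gd)
      show ?thesis
      proof (cases "v + g \<tau> = B")
        case True
        then have "w - g' \<tau> < 0" using that by simp
        from DERIV_neg_dec_right[OF dd this] obtain d where "d > 0" "\<forall>h>0. h < d \<longrightarrow> v + (0 + h) * w + g (\<tau> - (0 + h)) < v + 0 * w + g (\<tau> - 0)"
          by auto
        then show ?thesis using True unfolding eventually_at_right_field
          by (intro exI[of _ d]) force
      next
        case False
        have "((\<lambda>e. v + e * w + g (\<tau> - e)) \<longlongrightarrow> v + 0 * w + g (\<tau> - 0)) (at 0)"
          using DERIV_isCont[OF dd] by (simp add: isCont_def)
        then have "((\<lambda>e. v + e * w + g (\<tau> - e)) \<longlongrightarrow> v + 0 * w + g (\<tau> - 0)) (at_right 0)"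
          by (rule filterlim_mono) (auto simp: at_within_le_at at_le)
        then have "\<forall>\<^sub>F e in at_right 0. v + e * w + g (\<tau> - e) < B"
          using False that(1) by (intro order_tendstoD(2)) (auto simp: less_le)
        then show ?thesis by (rule eventually_mono) simp
      qed
    qed
    have "\<forall>\<^sub>F e in at_right 0. (\<tau> - e, y + of_real e * b) \<in> K"
    proof -
      have "\<forall>\<^sub>F e in at_right 0. Re y + e * Re b + g (\<tau> - e) \<le> L"
        using inK Ab(4) by (intro side) (auto simp: K_def)
      moreover have "\<forall>\<^sub>F e in at_right 0. Im y + e * Im b + g (\<tau> - e) \<le> \<Theta>"
        using inK Ab(5) by (intro side) (auto simp: K_def)
      moreover have "\<forall>\<^sub>F e in at_right 0. - Im y + e * (- Im b) + g (\<tau> - e) \<le> \<Theta>"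
        using inK Ab(6) by (intro side) (auto simp: K_def)
      moreover have "\<forall>\<^sub>F e in at_right 0. e < \<tau> - \<tau>0"
        using \<open>\<tau>0 < \<tau>\<close> unfolding eventually_at_right_field by (intro exI[of _ "\<tau> - \<tau>0"]) auto
      moreover have "\<forall>\<^sub>F e in at_right (0::real). 0 < e"
        by (simp add: eventually_at_right_less)
      ultimately show ?thesis
        by eventually_elim (use \<tau>_in in \<open>auto simp: K_def abs_if\<close>)
    qed
    with inc have "\<forall>\<^sub>F e in at_right (0::real). False"
    proof eventually_elim
      case (elim e)
      then show ?case using max[OF elim(2)] by (simp add: \<zeta>_def)
    qed
    then show False by simp
  qed
  have lim: "((\<lambda>s. norm (W \<tau>1 y1) * exp (a0 * (\<tau>1 - \<tau>0) + s * Re y1)) \<longlongrightarrow>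
      norm (W \<tau>1 y1) * exp (a0 * (\<tau>1 - \<tau>0) + 0 * Re y1)) (at_right 0)"
    by (intro tendsto_intros)
  have lim2: "((\<lambda>s. N * exp (s * L)) \<longlongrightarrow> N * exp (0 * L)) (at_right 0)"
    by (intro tendsto_intros)
  have "\<forall>\<^sub>F s in at_right 0. norm (W \<tau>1 y1) * exp (a0 * (\<tau>1 - \<tau>0) + s * Re y1) \<le> N * exp (s * L)"
    unfolding eventually_at_right_field
  proof (intro exI[of _ "a0 / bm"] conjI allI impI)
    show "0 < a0 / bm" using a0 bm by simp
    fix s assume "0 < s" "s < a0 / bm"
    then show "norm (W \<tau>1 y1) * exp (a0 * (\<tau>1 - \<tau>0) + s * Re y1) \<le> N * exp (s * L)"
      using weighted[of s] bm by (simp add: norm_mult field_simps)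
  qed
  from tendsto_le[OF _ lim2 lim this] have "norm (W \<tau>1 y1) * exp (a0 * (\<tau>1 - \<tau>0)) \<le> N" by simp
  moreover have "exp (- a0 * (\<tau>1 - \<tau>0)) = 1 / exp (a0 * (\<tau>1 - \<tau>0))"
    by (simp add: exp_minus inverse_eq_divide)
  ultimately show ?thesis by (simp add: pos_le_divide_eq)
qed

lemma norm_deriv_le_of_bound:
  assumes "f holomorphic_on S" "open S" "cball z r \<subseteq> S" "r > 0"
    and "\<And>w. w \<in> cball z r \<Longrightarrow> norm (f w) \<le> B"
  shows "norm (deriv f z) \<le> B / r"
proof -
  have "norm ((deriv ^^ 1) f z) \<le> fact 1 * B / r ^ 1"
  proof (intro Cauchy_inequality)
    show "f holomorphic_on ball z r"
      using assms(1,3) ball_subset_cball by (blast intro: holomorphic_on_subset)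
    show "continuous_on (cball z r) f"
      using assms(1,3) by (blast intro: holomorphic_on_subset holomorphic_on_imp_continuous_on)
  qed (use assms in \<open>auto simp: dist_norm\<close>)
  then show ?thesis by simp
qed

text \<open>Discs of radius \<open>\<nu>\<close> give \<open>|W\<^sub>y| \<le> \<nu>\<close>, so during one unit of time the drift is at most \<open>2 C1 \<nu>\<close>
  beyond \<open>G\<close>; this radius balances the two losses of domain.\<close>

lemma transport_step:
  fixes W :: "real \<Rightarrow> complex \<Rightarrow> complex" and G G' :: "real \<Rightarrow> real" and \<tau>m L \<Theta> a0 bm C1 k0 \<nu> D :: real
  defines "S \<equiv> {y. Re y < L \<and> \<bar>Im y\<bar> < \<Theta>}"
  assumes pos: "a0 > 0" "bm > 0" "C1 \<ge> 0" "\<nu> > 0" "2 * \<nu> \<le> k0" "\<nu> \<le> 1" "D > 0"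
    and G_nonneg: "\<And>\<tau>. \<tau> < \<tau>m \<Longrightarrow> 0 \<le> G \<tau>"
    and G_deriv: "\<And>\<tau>. \<tau> < \<tau>m \<Longrightarrow> (G has_real_derivative G' \<tau>) (at \<tau>)"
    and small: "\<And>\<tau>. \<tau> < \<tau>m \<Longrightarrow> D + (1 + 2 * C1) * \<nu> + G \<tau> \<le> \<Theta> / 2"
    and cont: "continuous_on ({..<\<tau>m} \<times> S) (\<lambda>(\<tau>, y). W \<tau> y)"
    and hol: "\<And>\<tau>. \<tau> < \<tau>m \<Longrightarrow> W \<tau> holomorphic_on S"
    and transport: "\<And>\<tau> y k. \<tau> < \<tau>m \<Longrightarrow> y \<in> S \<Longrightarrow> norm (W \<tau> y) + norm (deriv (W \<tau>) y) \<le> k \<Longrightarrow> k \<le> k0 \<Longrightarrow>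
       \<exists>A b. ((\<lambda>e. W (\<tau> - e) (y + of_real e * b)) has_vector_derivative (- A * W \<tau> y)) (at 0) \<and>
       Re A \<le> - 2 * a0 \<and> norm b \<le> bm \<and> Re b < C1 * k + G' \<tau> \<and>
       (\<Theta> / 2 \<le> Im y \<longrightarrow> Im b < C1 * k + G' \<tau>) \<and> (\<Theta> / 2 \<le> - Im y \<longrightarrow> - Im b < C1 * k + G' \<tau>)"
    and bound: "\<And>\<tau> y. \<tau> < \<tau>m \<Longrightarrow> Re y \<le> L - (D + G \<tau>) \<Longrightarrow> \<bar>Im y\<bar> \<le> \<Theta> - (D + G \<tau>) \<Longrightarrow> norm (W \<tau> y) \<le> \<nu>\<^sup>2"
    and pt: "\<tau>1 < \<tau>m" "Re y1 \<le> L - (D + (1 + 2 * C1) * \<nu> + G \<tau>1)" "\<bar>Im y1\<bar> \<le> \<Theta> - (D + (1 + 2 * C1) * \<nu> + G \<tau>1)"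
  shows "norm (W \<tau>1 y1) \<le> exp (- a0) * \<nu>\<^sup>2"
proof -
  \<comment> \<open>The loss of domain is \<open>D + \<nu> + G\<close> at time
    \<open>\<tau>1 - 1\<close> and grows to \<open>D + (1 + 2 * C1) * \<nu> + G\<close> at time
    \<open>\<tau>1\<close>. There is always room for discs of radius \<open>\<nu>\<close>, and the
    slope \<open>g'\<close> equals the drift bound \<open>C1 * k + G'\<close> for
    \<open>k = 2 * \<nu>\<close>.\<close>
  define g where "g = (\<lambda>\<tau>. D + \<nu> + G \<tau> + 2 * C1 * \<nu> * (\<tau> - \<tau>1 + 1))"
  define g' where "g' = (\<lambda>\<tau>. G' \<tau> + 2 * C1 * \<nu>)"
  have g_ge: "D + \<nu> + G \<tau> \<le> g \<tau>" if "\<tau>1 - 1 \<le> \<tau>" for \<tau>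
    using that pos unfolding g_def by simp
  \<comment> \<open>The lateral boundary \<open>\<bar>Im y\<bar> = \<Theta> - g \<tau>\<close>
    therefore lies in \<open>\<bar>Im y\<bar> \<ge> \<Theta> / 2\<close>, where the hypothesis
    controls the sign of the drift.\<close>
  have g_le: "g \<tau> \<le> \<Theta> / 2" if "\<tau> \<le> \<tau>1" for \<tau>
  proof -
    have "2 * C1 * \<nu> * (\<tau> - \<tau>1 + 1) \<le> 2 * C1 * \<nu> * 1"
      using that pos by (intro mult_left_mono) auto
    then show ?thesis using small[of \<tau>] that pt unfolding g_def by (simp add: algebra_simps)
  qed
  let ?K = "{(\<tau>, y). \<tau>1 - 1 \<le> \<tau> \<and> \<tau> \<le> \<tau>1 \<and> Re y \<le> L - g \<tau> \<and> \<bar>Im y\<bar> \<le> \<Theta> - g \<tau>}"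
  have "norm (W \<tau>1 y1) \<le> exp (- a0 * (\<tau>1 - (\<tau>1 - 1))) * \<nu>\<^sup>2"
  proof (rule transport_max_principle[where W = W and ?\<tau>0.0 = "\<tau>1 - 1" and g = g and g' = g' and L = L and \<Theta> = \<Theta> and bm = bm])
    show "0 \<le> g \<tau>" if "\<tau> \<in> {\<tau>1 - 1..\<tau>1}" for \<tau>
      using that g_ge[of \<tau>] G_nonneg[of \<tau>] pos pt by auto
    show "(g has_real_derivative g' \<tau>) (at \<tau>)" if "\<tau> \<in> {\<tau>1 - 1..\<tau>1}" for \<tau>
      using that G_deriv[of \<tau>] pt unfolding g_def g'_def by (auto intro!: derivative_eq_intros)
    have sub: "\<tau> < \<tau>m \<and> y \<in> S \<and> \<tau>1 - 1 \<le> \<tau> \<and> \<tau> \<le> \<tau>1 \<and> Re y \<le> L - (D + \<nu> + G \<tau>) \<and> \<bar>Im y\<bar> \<le> \<Theta> - (D + \<nu> + G \<tau>)"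
      if "(\<tau>, y) \<in> ?K" for \<tau> y
      using that g_ge[of \<tau>] G_nonneg[of \<tau>] pos pt unfolding S_def by auto
    show "continuous_on ?K (\<lambda>(\<tau>, y). W \<tau> y)"
      using cont by (rule continuous_on_subset) (use sub in auto)
    show "norm (W \<tau> y) \<le> \<nu>\<^sup>2" if "(\<tau>, y) \<in> ?K" for \<tau> y
      using sub[OF that] pos by (intro bound) auto
    show "\<exists>A b. ((\<lambda>e. W (\<tau> - e) (y + of_real e * b)) has_vector_derivative (- A * W \<tau> y)) (at 0) \<and>
       Re A \<le> - 2 * a0 \<and> norm b \<le> bm \<and> Re b < g' \<tau> \<and>
       (Im y = \<Theta> - g \<tau> \<longrightarrow> Im b < g' \<tau>) \<and> (- Im y = \<Theta> - g \<tau> \<longrightarrow> - Im b < g' \<tau>)"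
      if K: "(\<tau>, y) \<in> ?K" for \<tau> y
    proof -
      note s = sub[OF K]
      have near: "norm (W \<tau> w) \<le> \<nu>\<^sup>2 \<and> w \<in> S" if "w \<in> cball y \<nu>" for w
      proof -
        have "\<bar>Re w - Re y\<bar> \<le> \<nu>" "\<bar>Im w - Im y\<bar> \<le> \<nu>"
          using that abs_Re_le_cmod[of "w - y"] abs_Im_le_cmod[of "w - y"]
          by (auto simp: dist_norm norm_minus_commute)
        then show ?thesis
          using s G_nonneg[of \<tau>] pos by (auto intro!: bound simp: S_def)
      qed
      have "norm (deriv (W \<tau>) y) \<le> \<nu>\<^sup>2 / \<nu>"
      proof (rule norm_deriv_le_of_bound)
        show "W \<tau> holomorphic_on S" using hol s by blast
        have "S = {y. Re y < L} \<inter> {y. Im y < \<Theta>} \<inter> {y. - \<Theta> < Im y}"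
          by (auto simp: S_def)
        then show "open S" by (simp add: open_Int open_halfspace_Re_lt open_halfspace_Im_lt open_halfspace_Im_gt)
      qed (use near pos in auto)
      then have "norm (deriv (W \<tau>) y) \<le> \<nu>" using pos by (simp add: power2_eq_square)
      moreover have "\<nu>\<^sup>2 \<le> \<nu>" using pos by (simp add: power2_eq_square mult_le_cancel_left1)
      moreover have "norm (W \<tau> y) \<le> \<nu>\<^sup>2" using near[of y] pos by simp
      ultimately have "norm (W \<tau> y) + norm (deriv (W \<tau>) y) \<le> 2 * \<nu>" by simp
      from transport[OF _ _ this] s pos obtain A b where
        "((\<lambda>e. W (\<tau> - e) (y + of_real e * b)) has_vector_derivative (- A * W \<tau> y)) (at 0)"
        "Re A \<le> - 2 * a0" "norm b \<le> bm" "Re b < C1 * (2 * \<nu>) + G' \<tau>"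
        "\<Theta> / 2 \<le> Im y \<longrightarrow> Im b < C1 * (2 * \<nu>) + G' \<tau>" "\<Theta> / 2 \<le> - Im y \<longrightarrow> - Im b < C1 * (2 * \<nu>) + G' \<tau>"
        by blast
      then show ?thesis using g_le[of \<tau>] s unfolding g'_def
        by (intro exI[of _ A] exI[of _ b]) (auto simp: algebra_simps)
    qed
    show "(\<tau>1, y1) \<in> ?K" using pt pos by (auto simp: g_def algebra_simps)
  qed (use pos in auto)
  then show ?thesis by simp
qed

text \<open>Each application of \<open>transport_step\<close> multiplies the bound
  \<open>\<nu>\<^sup>2\<close> by \<open>exp (- a0)\<close>, that is, \<open>\<nu>\<close> by
  \<open>q\<close>. Since the bound holds for all times before \<open>\<tau>m\<close>, going back
  one unit costs nothing in time. The losses of domain form a geometric series that leaves a fixed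
  half strip, on which the bounds tend to 0.\<close>

lemma transport_vanishing:
  fixes W :: "real \<Rightarrow> complex \<Rightarrow> complex" and G G' :: "real \<Rightarrow> real" and \<tau>m L \<Theta> a0 bm C1 k0 \<nu>0 D0 :: real
  defines "S \<equiv> {y. Re y < L \<and> \<bar>Im y\<bar> < \<Theta>}" and "q \<equiv> exp (- a0 / 2)"
  assumes pos: "a0 > 0" "bm > 0" "C1 \<ge> 0" "\<nu>0 > 0" "2 * \<nu>0 \<le> k0" "\<nu>0 \<le> 1" "D0 > 0"
    and G_nonneg: "\<And>\<tau>. \<tau> < \<tau>m \<Longrightarrow> 0 \<le> G \<tau>"
    and G_deriv: "\<And>\<tau>. \<tau> < \<tau>m \<Longrightarrow> (G has_real_derivative G' \<tau>) (at \<tau>)"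
    and small: "\<And>\<tau>. \<tau> < \<tau>m \<Longrightarrow> D0 + (1 + 2 * C1) * \<nu>0 / (1 - q) + G \<tau> \<le> \<Theta> / 2"
    and cont: "continuous_on ({..<\<tau>m} \<times> S) (\<lambda>(\<tau>, y). W \<tau> y)"
    and hol: "\<And>\<tau>. \<tau> < \<tau>m \<Longrightarrow> W \<tau> holomorphic_on S"
    and transport: "\<And>\<tau> y k. \<tau> < \<tau>m \<Longrightarrow> y \<in> S \<Longrightarrow> norm (W \<tau> y) + norm (deriv (W \<tau>) y) \<le> k \<Longrightarrow> k \<le> k0 \<Longrightarrow>
       \<exists>A b. ((\<lambda>e. W (\<tau> - e) (y + of_real e * b)) has_vector_derivative (- A * W \<tau> y)) (at 0) \<and>
       Re A \<le> - 2 * a0 \<and> norm b \<le> bm \<and> Re b < C1 * k + G' \<tau> \<and>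
       (\<Theta> / 2 \<le> Im y \<longrightarrow> Im b < C1 * k + G' \<tau>) \<and> (\<Theta> / 2 \<le> - Im y \<longrightarrow> - Im b < C1 * k + G' \<tau>)"
    and bound: "\<And>\<tau> y. \<tau> < \<tau>m \<Longrightarrow> y \<in> S \<Longrightarrow> norm (W \<tau> y) \<le> \<nu>0\<^sup>2"
    and pt: "\<tau> < \<tau>m" "Re y \<le> L - \<Theta> / 2" "\<bar>Im y\<bar> \<le> \<Theta> / 2"
  shows "W \<tau> y = 0"
proof -
  have q: "0 < q" "q < 1" "q\<^sup>2 = exp (- a0)"
    using pos by (auto simp: q_def power2_eq_square simp flip: exp_add)
  \<comment> \<open>The domain lost after \<open>j\<close> steps. The positive start
    \<open>D0\<close> places the first closed region inside the open half strip
    \<open>S\<close>.\<close>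
  define D where "D = (\<lambda>j. D0 + (1 + 2 * C1) * \<nu>0 * (\<Sum>i<j. q ^ i))"
  have D_le: "D j \<le> D0 + (1 + 2 * C1) * \<nu>0 / (1 - q)" for j
  proof -
    have "(\<Sum>i<j. q ^ i) = (1 - q ^ j) / (1 - q)"
      using q by (simp add: sum_gp_strict)
    also have "\<dots> \<le> 1 / (1 - q)" using q by (intro divide_right_mono) auto
    finally have "(1 + 2 * C1) * \<nu>0 * (\<Sum>i<j. q ^ i) \<le> (1 + 2 * C1) * \<nu>0 * (1 / (1 - q))"
      using pos by (intro mult_left_mono) auto
    then show ?thesis by (simp add: D_def)
  qed
  have D_pos: "D j > 0" for j
    using pos q by (auto simp: D_def intro!: add_pos_nonneg mult_nonneg_nonneg sum_nonneg)
  have D_Suc: "D (Suc j) = D j + (1 + 2 * C1) * (\<nu>0 * q ^ j)" for j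
    by (simp add: D_def algebra_simps)
  have main: "norm (W \<tau> y) \<le> (\<nu>0 * q ^ j)\<^sup>2"
    if "\<tau> < \<tau>m" "Re y \<le> L - (D j + G \<tau>)" "\<bar>Im y\<bar> \<le> \<Theta> - (D j + G \<tau>)" for j \<tau> y
    using that
  proof (induction j arbitrary: \<tau> y)
    case 0
    then show ?case using bound[of \<tau> y] D_pos[of 0] G_nonneg[of \<tau>] by (auto simp: S_def)
  next
    case (Suc j)
    have qj: "q ^ j \<le> 1" using q by (simp add: power_le_one)
    have \<nu>: "\<nu>0 * q ^ j > 0" "\<nu>0 * q ^ j \<le> \<nu>0" using pos q qj by (auto simp: mult_le_cancel_left1)
    have "norm (W \<tau> y) \<le> exp (- a0) * (\<nu>0 * q ^ j)\<^sup>2"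
    proof (rule transport_step[where W = W and \<tau>m = \<tau>m and G = G and G' = G' and L = L and \<Theta> = \<Theta> and
          bm = bm and ?C1.0 = C1 and ?k0.0 = k0 and D = "D j"])
      show "D j + (1 + 2 * C1) * (\<nu>0 * q ^ j) + G \<tau>' \<le> \<Theta> / 2" if "\<tau>' < \<tau>m" for \<tau>'
        using D_le[of "Suc j"] small[OF that] unfolding D_Suc by linarith
    qed (use Suc pos \<nu> D_pos G_nonneg G_deriv cont hol transport in \<open>auto simp: D_Suc S_def\<close>)
    also have "\<dots> = (\<nu>0 * q ^ Suc j)\<^sup>2"
      by (simp add: power_mult_distrib flip: q(3))
    finally show ?case .
  qed
  have "norm (W \<tau> y) \<le> (\<nu>0 * q ^ j)\<^sup>2" for j
  proof (rule main)
    have "D j + G \<tau> \<le> \<Theta> / 2" using D_le[of j] small[OF pt(1)] by linarith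
    then show "Re y \<le> L - (D j + G \<tau>)" "\<bar>Im y\<bar> \<le> \<Theta> - (D j + G \<tau>)" using pt by linarith+
  qed (rule pt)
  moreover have lim: "(\<lambda>j. (\<nu>0 * q ^ j)\<^sup>2) \<longlonglongrightarrow> (\<nu>0 * 0)\<^sup>2"
    using q by (intro tendsto_intros LIMSEQ_power_zero) auto
  ultimately have "norm (W \<tau> y) \<le> (\<nu>0 * 0)\<^sup>2"
    using LIMSEQ_le_const[OF lim] by blast
  then show ?thesis by simp
qed

section \<open>The nonlinear remainder\<close>

text \<open>The quadratic bound near 0 makes the singularity of \<open>f z / z\<^sup>2\<close>
  removable. The maximum principle on the circles of radius \<open>s < r\<close>, followed by
  \<open>s\<close> tending to \<open>r\<close>, gives the estimate. The constant \<open>K\<close>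
  only serves removability and does not enter the result.\<close>

lemma Schwarz_order_two:
  fixes f :: "complex \<Rightarrow> complex"
  assumes hol: "f holomorphic_on ball 0 r" and bound: "\<And>z. z \<in> ball 0 r \<Longrightarrow> norm (f z) \<le> B"
    and zero: "\<And>z. norm z \<le> \<delta> \<Longrightarrow> norm (f z) \<le> K * (norm z)\<^sup>2" and "\<delta> > 0"
    and z: "z \<in> ball 0 r"
  shows "norm (f z) \<le> B * (norm z / r)\<^sup>2"
proof -
  have r: "r > 0" using z by (auto simp: dist_norm intro: le_less_trans[OF norm_ge_zero])
  have f0: "f 0 = 0" using zero[of 0] \<open>\<delta> > 0\<close> by simp
  have "(\<lambda>z. f z / z\<^sup>2) \<in> O[at 0](\<lambda>_. 1)"
  proof (rule bigoI)
    show "\<forall>\<^sub>F z in at 0. norm (f z / z\<^sup>2) \<le> K * norm (1::complex)"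
      unfolding eventually_at using \<open>\<delta> > 0\<close> zero
      by (auto simp: norm_power norm_divide divide_le_eq intro!: exI[of _ \<delta>])
  qed
  then have "\<exists>g. g holomorphic_on ball 0 r \<and> (\<forall>z\<in>ball 0 r - {0}. g z = f z / z\<^sup>2)"
    using r by (intro removable_singularities)
       (auto intro!: holomorphic_intros intro: holomorphic_on_subset[OF hol])
  then obtain g where g: "g holomorphic_on ball 0 r" "\<And>z. z \<in> ball 0 r \<Longrightarrow> z \<noteq> 0 \<Longrightarrow> g z = f z / z\<^sup>2"
    by auto
  show ?thesis
  proof (cases "z = 0")
    case False
    have le: "norm (g z) \<le> B / s\<^sup>2" if s: "norm z < s" "s < r" for s
    proof (rule maximum_modulus_frontier[of g "ball 0 s"])
      have s0: "0 < s" using s(1) norm_ge_zero[of z] by linarith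
      have "cball (0::complex) s \<subseteq> ball 0 r" using s(2) by auto
      then have "g holomorphic_on cball 0 s" using g(1) by (rule holomorphic_on_subset[rotated])
      then show "g holomorphic_on interior (ball 0 s)" "continuous_on (closure (ball 0 s)) g"
        using ball_subset_cball s0 by (auto intro: holomorphic_on_subset holomorphic_on_imp_continuous_on)
      fix w :: complex assume "w \<in> frontier (ball 0 s)"
      then have w: "norm w = s" using s0 by (simp add: frontier_ball)
      moreover have "w \<noteq> 0" using w s0 by auto
      ultimately show "norm (g w) \<le> B / s\<^sup>2"
        using s bound[of w] by (simp add: g norm_divide norm_power divide_right_mono)
    qed (use s in auto)
    have "((\<lambda>s. B / s\<^sup>2) \<longlongrightarrow> B / r\<^sup>2) (at_left r)"
      using r by (intro tendsto_intros) auto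
    moreover have "\<forall>\<^sub>F s in at_left r. norm (g z) \<le> B / s\<^sup>2"
      using le z unfolding eventually_at_left_field by (intro exI[of _ "norm z"]) auto
    ultimately have "norm (g z) \<le> B / r\<^sup>2"
      by (intro tendsto_lowerbound) auto
    then have "norm (f z) / (norm z)\<^sup>2 \<le> B / r\<^sup>2"
      using g(2)[OF z False] by (simp add: norm_divide norm_power)
    then show ?thesis using False r by (simp add: field_simps)
  qed (simp add: f0)
qed

text \<open>Cauchy's inequality on discs of radius \<open>r / 4\<close>, which stay in the ball of
  radius \<open>r\<close> when centred in the half ball.\<close>

lemma holomorphic_lipschitz_half_ball:
  fixes f :: "complex \<Rightarrow> complex"
  assumes hol: "f holomorphic_on ball 0 r" and r: "r > 0"
    and bound: "\<And>z. z \<in> ball 0 r \<Longrightarrow> norm (f z) \<le> B"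
    and z: "z \<in> ball 0 (r / 2)" "w \<in> ball 0 (r / 2)"
  shows "norm (f z - f w) \<le> 4 * B / r * norm (z - w)"
proof (rule field_differentiable_bound[OF convex_ball _ _ z])
  fix y assume y: "y \<in> ball (0::complex) (r / 2)"
  then show "(f has_field_derivative deriv f y) (at y within ball 0 (r / 2))"
    using r by (intro has_field_derivative_at_within[OF holomorphic_derivI[OF hol]]) auto
  have sub: "cball y (r / 4) \<subseteq> ball 0 r"
  proof
    fix v assume "v \<in> cball y (r / 4)"
    then show "v \<in> ball 0 r"
      using y r norm_triangle_ineq[of y "v - y"] by (simp add: dist_norm norm_minus_commute)
  qed
  have "norm (deriv f y) \<le> B / (r / 4)"
    using sub bound r by (intro norm_deriv_le_of_bound[OF hol]) auto
  then show "norm (deriv f y) \<le> 4 * B / r" by (simp add: mult.commute)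
qed

text \<open>Reduces joint holomorphy to functions of one variable with \<open>x\<close> frozen. It
  is applied to the coordinate lines in \<open>u\<close> and \<open>v\<close> and to the rays
  \<open>z \<mapsto> (z * u, z * v)\<close>.\<close>

lemma holomorphic3_on_curve:
  assumes f: "holomorphic3_on (\<lambda>(x, u, v). f x u v) U" and "(x, \<phi> z, \<psi> z) \<in> U"
    and \<phi>: "(\<phi> has_field_derivative a) (at z)" and \<psi>: "(\<psi> has_field_derivative b) (at z)"
  shows "(\<lambda>z. f x (\<phi> z) (\<psi> z)) field_differentiable at z"
proof -
  obtain p q r where d: "((\<lambda>(x, u, v). f x u v) has_derivative (\<lambda>(h, k, l). p * h + q * k + r * l)) (at (x, \<phi> z, \<psi> z))"
    using assms unfolding holomorphic3_on_def by blast
  have "((\<lambda>z. (x, \<phi> z, \<psi> z)) has_derivative (\<lambda>h. (0, a * h, b * h))) (at z)"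
    using \<phi> \<psi> by (intro has_derivative_Pair has_derivative_const) (auto simp: has_field_derivative_def)
  from has_derivative_compose[OF this d]
  have "((\<lambda>z. f x (\<phi> z) (\<psi> z)) has_derivative (\<lambda>h. q * (a * h) + r * (b * h))) (at z)"
    by simp
  moreover have "(\<lambda>h. q * (a * h) + r * (b * h)) = (*) (q * a + r * b)"
    by (auto simp: algebra_simps)
  ultimately show ?thesis
    unfolding field_differentiable_def has_field_derivative_def by metis
qed

text \<open>The Taylor series converges absolutely at \<open>(u, v)\<close>, and passing to
  \<open>(z * u, z * v)\<close> multiplies its term of index \<open>(i, j)\<close> by
  \<open>z ^ (i + j)\<close> with \<open>i + j \<ge> 2\<close>. The constant depends on the point,
  which suffices for the removability condition in \<open>Schwarz_order_two\<close>.\<close>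

lemma remainder_quadratic_on_rays:
  assumes R2: "remainder_function T0 R0 \<rho>0 R2" and \<Omega>: "(t, x, u, v) \<in> Omega T0 R0 \<rho>0"
  shows "\<exists>K. \<forall>z. norm z \<le> 1 \<longrightarrow> norm (R2 t x (z * u) (z * v)) \<le> K * (norm z)\<^sup>2"
proof -
  let ?I = "{(i, j). i + j \<ge> (2::nat)}"
  obtain a where a: "\<And>t x u v. (t, x, u, v) \<in> Omega T0 R0 \<rho>0 \<Longrightarrow>
     ((\<lambda>(i, j). a i j t x * u ^ i * v ^ j) has_sum R2 t x u v) ?I"
    using R2 unfolding remainder_function_def by blast
  define c where "c = (\<lambda>(i, j). a i j t x * u ^ i * v ^ j)"
  have c: "(\<lambda>n. norm (c n)) summable_on ?I"
    using has_sum_imp_summable[OF a[OF \<Omega>]] unfolding c_def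
    by (simp only: summable_on_iff_abs_summable_on_complex)
  have "norm (R2 t x (z * u) (z * v)) \<le> (\<Sum>\<^sub>\<infinity>n\<in>?I. norm (c n)) * (norm z)\<^sup>2" if z: "norm z \<le> 1" for z
  proof -
    have "norm (z * w) < \<rho>0" if "norm w < \<rho>0" for w
      using that mult_right_mono[OF z norm_ge_zero[of w]] by (simp add: norm_mult)
    then have "(t, x, z * u, z * v) \<in> Omega T0 R0 \<rho>0"
      using \<Omega> by (auto simp: Omega_def)
    from a[OF this]
    have s: "((\<lambda>(i, j). a i j t x * (z * u) ^ i * (z * v) ^ j) has_sum R2 t x (z * u) (z * v)) ?I" .
    have le: "norm ((\<lambda>(i, j). a i j t x * (z * u) ^ i * (z * v) ^ j) n) \<le> norm (c n) * (norm z)\<^sup>2" if "n \<in> ?I" for n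
    proof -
      obtain i j where n: "n = (i, j)" by force
      have "a i j t x * (z * u) ^ i * (z * v) ^ j = c n * z ^ (i + j)"
        by (simp add: n c_def power_mult_distrib power_add algebra_simps)
      moreover have "norm (z ^ (i + j)) \<le> (norm z)\<^sup>2"
        using that z n by (auto simp: norm_power intro: power_decreasing)
      ultimately show ?thesis by (simp add: n norm_mult mult_left_mono)
    qed
    have "norm (R2 t x (z * u) (z * v)) \<le> (\<Sum>\<^sub>\<infinity>n\<in>?I. norm (c n) * (norm z)\<^sup>2)"
      by (rule norm_infsum_le[OF s has_sum_infsum[OF summable_on_cmult_left[OF c]] le])
    also have "\<dots> = (\<Sum>\<^sub>\<infinity>n\<in>?I. norm (c n)) * (norm z)\<^sup>2"
      by (rule infsum_cmult_left) (rule c)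
    finally show ?thesis .
  qed
  then show ?thesis by blast
qed

lemma continuous_on_compact_bounded:
  fixes f :: "'a::euclidean_space \<Rightarrow> complex"
  assumes "continuous_on S f" "compact K" "K \<subseteq> S"
  obtains B where "B \<ge> 0" "\<And>z. z \<in> K \<Longrightarrow> norm (f z) \<le> B"
proof -
  have "bounded (f ` K)"
    using assms by (intro compact_imp_bounded compact_continuous_image) (auto intro: continuous_on_subset)
  then obtain B where "B > 0" "\<forall>y\<in>f ` K. norm y \<le> B" unfolding bounded_pos by blast
  then show ?thesis using that[of B] by auto
qed

text \<open>A plain Lipschitz bound comes from Cauchy's inequality; the extra factor \<open>m\<close> comes from applying
  the Schwarz lemma of order two to \<open>z \<mapsto> R2 (z u) (z v) - R2 (z u') (z v')\<close> on the disc of radius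
  \<open>\<rho>0 / (4 m)\<close> and evaluating at \<open>z = 1\<close>.\<close>

lemma remainder_lipschitz:
  assumes R2: "remainder_function T0 R0 \<rho>0 R2" and pos: "R0 > 0" "\<rho>0 > 0"
  shows "\<exists>C\<ge>0. \<exists>r>0. \<forall>t x m u v u' v'. t \<in> {0..T0} \<longrightarrow> norm x \<le> R0 / 2 \<longrightarrow> m \<le> r \<longrightarrow>
    norm u \<le> m \<longrightarrow> norm v \<le> m \<longrightarrow> norm u' \<le> m \<longrightarrow> norm v' \<le> m \<longrightarrow>
    norm (R2 t x u v - R2 t x u' v') \<le> C * m * (norm (u - u') + norm (v - v'))"
proof -
  let ?K = "{0..T0} \<times> cball (0::complex) (R0 / 2) \<times> cball (0::complex) (\<rho>0 / 2) \<times> cball (0::complex) (\<rho>0 / 2)"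
  have K: "compact ?K" "?K \<subseteq> Omega T0 R0 \<rho>0"
    using pos by (auto simp: Omega_def intro!: compact_Times)
  have "continuous_on (Omega T0 R0 \<rho>0) (\<lambda>(t, x, u, v). R2 t x u v)"
    using R2 by (simp add: remainder_function_def)
  from continuous_on_compact_bounded[OF this K] obtain B where B: "B \<ge> 0"
    "\<And>z. z \<in> ?K \<Longrightarrow> norm ((\<lambda>(t, x, u, v). R2 t x u v) z) \<le> B" by blast
  have bound: "norm (R2 t x u v) \<le> B"
    if "t \<in> {0..T0}" "norm x \<le> R0 / 2" "norm u \<le> \<rho>0 / 2" "norm v \<le> \<rho>0 / 2" for t x u v
    using that B(2)[of "(t, x, u, v)"] by simp
  have curve: "(\<lambda>z. R2 t x (\<phi> z) (\<psi> z)) field_differentiable at z"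
    if "t \<in> {0..T0}" "norm x \<le> R0 / 2" "norm (\<phi> z) < \<rho>0" "norm (\<psi> z) < \<rho>0"
      "(\<phi> has_field_derivative a) (at z)" "(\<psi> has_field_derivative b) (at z)" for t x \<phi> \<psi> z a b
  proof (rule holomorphic3_on_curve[OF _ _ that(5,6)])
    show "holomorphic3_on (\<lambda>(x, u, v). R2 t x u v) (ball 0 R0 \<times> ball 0 \<rho>0 \<times> ball 0 \<rho>0)"
      using R2 that by (simp add: remainder_function_def)
  qed (use that pos in auto)
  \<comment> \<open>The value of \<open>4 * B / r\<close> for \<open>r = \<rho>0 / 2\<close>:
    Lipschitz estimates in one variable at a time on the half ball of radius
    \<open>\<rho>0 / 4\<close>.\<close>
  define C where "C = 8 * B / \<rho>0"
  have C: "C \<ge> 0" using B pos by (simp add: C_def)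
  have lip: "norm (R2 t x u v - R2 t x u' v') \<le> C * (norm (u - u') + norm (v - v'))"
    if tx: "t \<in> {0..T0}" "norm x \<le> R0 / 2"
      and uv: "norm u < \<rho>0 / 4" "norm v < \<rho>0 / 4" "norm u' < \<rho>0 / 4" "norm v' < \<rho>0 / 4" for t x u v u' v'
  proof -
    have n1: "norm (R2 t x u v - R2 t x u' v) \<le> 4 * B / (\<rho>0 / 2) * norm (u - u')"
    proof (rule holomorphic_lipschitz_half_ball)
      show "(\<lambda>u. R2 t x u v) holomorphic_on ball 0 (\<rho>0 / 2)"
        unfolding holomorphic_on_def
        using tx uv pos
        by (intro ballI field_differentiable_at_within[OF curve[of _ _ "\<lambda>u. u" _ "\<lambda>_. v" 1 0]]) auto
    qed (use tx uv pos in \<open>auto intro!: bound\<close>)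
    have n2: "norm (R2 t x u' v - R2 t x u' v') \<le> 4 * B / (\<rho>0 / 2) * norm (v - v')"
    proof (rule holomorphic_lipschitz_half_ball)
      show "(\<lambda>v. R2 t x u' v) holomorphic_on ball 0 (\<rho>0 / 2)"
        unfolding holomorphic_on_def
        using tx uv pos
        by (intro ballI field_differentiable_at_within[OF curve[of _ _ "\<lambda>_. u'" _ "\<lambda>v. v" 0 1]]) auto
    qed (use tx uv pos in \<open>auto intro!: bound\<close>)
    have eqC: "4 * B / (\<rho>0 / 2) = C" by (simp add: C_def)
    have "norm (R2 t x u v - R2 t x u' v')
        \<le> norm (R2 t x u v - R2 t x u' v) + norm (R2 t x u' v - R2 t x u' v')"
      using norm_triangle_ineq[of "R2 t x u v - R2 t x u' v" "R2 t x u' v - R2 t x u' v'"] by simp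
    then show ?thesis using n1 n2 unfolding eqC distrib_left by linarith
  qed
  have main: "norm (R2 t x u v - R2 t x u' v') \<le> 4 * C / \<rho>0 * m * (norm (u - u') + norm (v - v'))"
    if tx: "t \<in> {0..T0}" "norm x \<le> R0 / 2" and m: "m \<le> \<rho>0 / 8"
      and uv: "norm u \<le> m" "norm v \<le> m" "norm u' \<le> m" "norm v' \<le> m" for t x m u v u' v'
  proof (cases "m = 0")
    case True
    then show ?thesis using uv by simp
  next
    case False
    then have m0: "m > 0" using uv(1) norm_ge_zero[of u] by linarith
    define r where "r = \<rho>0 / (4 * m)"
    have r: "1 < r" "r * m = \<rho>0 / 4" using m m0 pos by (auto simp: r_def field_simps)
    let ?g = "\<lambda>z. R2 t x (z * u) (z * v) - R2 t x (z * u') (z * v')"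
    let ?\<Delta> = "norm (u - u') + norm (v - v')"
    have small: "norm (z * w) < \<rho>0 / 4" if "norm z < r" "norm w \<le> m" for z w :: complex
    proof -
      have "norm z * norm w \<le> norm z * m" using that by (intro mult_left_mono) auto
      also have "\<dots> < r * m" using that m0 by simp
      finally show ?thesis using r by (simp add: norm_mult)
    qed
    \<comment> \<open>The Lipschitz bound gives \<open>C * r * ?\<Delta>\<close> on the disc; the
      order two zero divides this by \<open>r\<^sup>2\<close>. What remains,
      \<open>C * ?\<Delta> / r\<close>, carries the factor \<open>m\<close>.\<close>
    have "norm (?g 1) \<le> (C * r * ?\<Delta>) * (norm (1::complex) / r)\<^sup>2"
    proof -
      obtain K1 where K1: "\<And>z. norm z \<le> 1 \<Longrightarrow> norm (R2 t x (z * u) (z * v)) \<le> K1 * (norm z)\<^sup>2"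
        using remainder_quadratic_on_rays[OF R2, of t x u v] tx uv m pos by (auto simp: Omega_def)
      obtain K2 where K2: "\<And>z. norm z \<le> 1 \<Longrightarrow> norm (R2 t x (z * u') (z * v')) \<le> K2 * (norm z)\<^sup>2"
        using remainder_quadratic_on_rays[OF R2, of t x u' v'] tx uv m pos by (auto simp: Omega_def)
      show ?thesis
      proof (rule Schwarz_order_two[of ?g r _ 1 "K1 + K2"])
        show "?g holomorphic_on ball 0 r"
        proof (intro holomorphic_on_diff)
          have "(\<lambda>z. R2 t x (z * w) (z * w')) holomorphic_on ball 0 r" if "norm w \<le> m" "norm w' \<le> m" for w w'
            unfolding holomorphic_on_def
          proof
            fix z :: complex assume z: "z \<in> ball 0 r"
            have "(\<lambda>z. R2 t x (z * w) (z * w')) field_differentiable at z"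
              using small[of z w] small[of z w'] z that tx pos
              by (intro curve[of _ _ "\<lambda>z. z * w" _ "\<lambda>z. z * w'" w w']) (auto intro!: derivative_eq_intros)
            then show "(\<lambda>z. R2 t x (z * w) (z * w')) field_differentiable at z within ball 0 r"
              by (rule field_differentiable_at_within)
          qed
          then show "(\<lambda>z. R2 t x (z * u) (z * v)) holomorphic_on ball 0 r"
            "(\<lambda>z. R2 t x (z * u') (z * v')) holomorphic_on ball 0 r" using uv by blast+
        qed
        show "norm (?g z) \<le> C * r * ?\<Delta>" if z: "z \<in> ball 0 r" for z
        proof -
          have "norm (?g z) \<le> C * (norm (z * u - z * u') + norm (z * v - z * v'))"
            using z uv by (intro lip tx small) auto
          also have "\<dots> = C * (norm z * ?\<Delta>)"
            by (simp add: norm_mult distrib_left flip: right_diff_distrib)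
          also have "\<dots> \<le> C * (r * ?\<Delta>)"
            using z C by (intro mult_left_mono mult_right_mono) auto
          finally show ?thesis by (simp add: mult.assoc)
        qed
        show "norm (?g z) \<le> (K1 + K2) * (norm z)\<^sup>2" if "norm z \<le> 1" for z
          using K1[OF that] K2[OF that] norm_triangle_ineq4[of "R2 t x (z * u) (z * v)" "R2 t x (z * u') (z * v')"]
          unfolding distrib_right by linarith
      qed (use r in auto)
    qed
    also have "(C * r * ?\<Delta>) * (norm (1::complex) / r)\<^sup>2 = 4 * C / \<rho>0 * m * ?\<Delta>"
      using m0 pos by (simp add: r_def power2_eq_square field_simps)
    finally show ?thesis by simp
  qed
  have "4 * C / \<rho>0 \<ge> 0" "\<rho>0 / 8 > 0" using C pos by auto
  then show ?thesis using main by blast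
qed

section \<open>Behaviour of the data near the origin\<close>

text \<open>The variation in \<open>x\<close> is Lipschitz uniformly in \<open>t\<close> by Cauchy's
  inequality; the variation in \<open>t\<close> at \<open>x = 0\<close> is controlled by continuity.
  It matters that \<open>K\<close> does not depend on \<open>\<kappa>\<close>: the spatial radius is
  fixed through \<open>K\<close> first, and \<open>\<kappa>\<close> is later chosen proportional to
  the opening of the sector.\<close>

lemma coefficient_near_origin:
  assumes f: "coefficient_function T0 R0 f" and pos: "T0 > 0" "R0 > 0"
  shows "\<exists>K\<ge>0. \<forall>\<kappa>>0. \<forall>\<^sub>F t in at_right 0. \<forall>x\<in>ball 0 (R0 / 4). norm (f t x - f 0 0) \<le> K * norm x + \<kappa>"
proof -
  have cont: "continuous_on ({0..T0} \<times> ball 0 R0) (\<lambda>(t, x). f t x)"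
    and hol: "\<And>t. t \<in> {0..T0} \<Longrightarrow> f t holomorphic_on ball 0 R0"
    using f by (auto simp: coefficient_function_def)
  have "compact ({0..T0} \<times> cball (0::complex) (R0 / 2))" "{0..T0} \<times> cball (0::complex) (R0 / 2) \<subseteq> {0..T0} \<times> ball 0 R0"
    using pos by (auto intro: compact_Times)
  from continuous_on_compact_bounded[OF cont this] obtain B where B: "B \<ge> 0"
    "\<And>z. z \<in> {0..T0} \<times> cball 0 (R0 / 2) \<Longrightarrow> norm ((\<lambda>(t, x). f t x) z) \<le> B" by blast
  have lip: "norm (f t x - f t 0) \<le> 8 * B / R0 * norm x" if "t \<in> {0..T0}" "x \<in> ball 0 (R0 / 4)" for t x
  proof -
    have "norm (f t x - f t 0) \<le> 4 * B / (R0 / 2) * norm (x - 0)"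
    proof (rule holomorphic_lipschitz_half_ball)
      show "f t holomorphic_on ball 0 (R0 / 2)"
        using hol[OF that(1)] by (rule holomorphic_on_subset) (use pos in auto)
      show "norm (f t z) \<le> B" if "z \<in> ball 0 (R0 / 2)" for z
        using B(2)[of "(t, z)"] that \<open>t \<in> {0..T0}\<close> by auto
    qed (use that pos in auto)
    then show ?thesis by simp
  qed
  have "continuous_on {0..T0} (\<lambda>t. (\<lambda>(t, x). f t x) (t, 0))"
    by (rule continuous_on_compose2[OF cont]) (use pos in \<open>auto intro!: continuous_intros\<close>)
  then have "((\<lambda>t. f t 0) \<longlongrightarrow> f 0 0) (at 0 within {0..T0})"
    using pos by (simp add: continuous_on_def)
  then have lim: "((\<lambda>t. f t 0) \<longlongrightarrow> f 0 0) (at_right 0)"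
    using pos by (simp add: at_within_Icc_at_right)
  have "\<forall>\<^sub>F t in at_right 0. \<forall>x\<in>ball 0 (R0 / 4). norm (f t x - f 0 0) \<le> 8 * B / R0 * norm x + \<kappa>"
    if "\<kappa> > 0" for \<kappa>
  proof -
    have "\<forall>\<^sub>F t in at_right 0. dist (f t 0) (f 0 0) < \<kappa>" using tendstoD[OF lim that] .
    moreover have "\<forall>\<^sub>F t in at_right 0. t \<in> {0<..<T0}" using pos by (intro eventually_at_right_real)
    ultimately show ?thesis
    proof eventually_elim
      case (elim t)
      show ?case
      proof
        fix x :: complex assume "x \<in> ball 0 (R0 / 4)"
        with elim have "norm (f t x - f t 0) \<le> 8 * B / R0 * norm x" by (intro lip) auto
        moreover have "norm (f t x - f 0 0) \<le> norm (f t x - f t 0) + norm (f t 0 - f 0 0)"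
          using norm_triangle_ineq[of "f t x - f t 0" "f t 0 - f 0 0"] by simp
        ultimately show "norm (f t x - f 0 0) \<le> 8 * B / R0 * norm x + \<kappa>"
          using elim by (simp add: dist_norm)
      qed
    qed
  qed
  then show ?thesis using B pos by (intro exI[of _ "8 * B / R0"]) auto
qed

lemma sup_bigo_pointwise:
  assumes "sup_bigo R0 f \<mu>"
  shows "\<exists>C\<ge>0. \<forall>\<^sub>F t in at_right 0. \<forall>x\<in>ball 0 R0. norm (f t x) \<le> C * \<bar>\<mu> t\<bar>"
proof -
  obtain C where C: "\<forall>\<^sub>F t in at_right 0. (SUP x\<in>ball 0 R0. ereal (norm (f t x))) \<le> ereal (C * \<mu> t)"
    using assms by (auto simp: sup_bigo_def)
  have "\<forall>\<^sub>F t in at_right 0. \<forall>x\<in>ball 0 R0. norm (f t x) \<le> \<bar>C\<bar> * \<bar>\<mu> t\<bar>"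
    using C
  proof eventually_elim
    case (elim t)
    show ?case
    proof
      fix x :: complex assume "x \<in> ball 0 R0"
      then have "ereal (norm (f t x)) \<le> ereal (C * \<mu> t)" using elim by (meson SUP_upper order_trans)
      then show "norm (f t x) \<le> \<bar>C\<bar> * \<bar>\<mu> t\<bar>" by (simp flip: abs_mult)
    qed
  qed
  then show ?thesis by (intro exI[of _ "\<bar>C\<bar>"]) simp
qed

text \<open>\<open>Lim\<close> carries information only if the limit exists. Here the quantity is
  monotone in \<open>\<sigma>\<close>, so the limit exists and equals the infimum over
  \<open>\<sigma> > 0\<close>; an infimum below \<open>\<epsilon>\<close> yields a suitable
  \<open>\<sigma>\<close>.\<close>

lemma limsup_smallness:
  fixes u :: "real \<Rightarrow> complex \<Rightarrow> complex"
  assumes "Limsup (at_right 0) (\<lambda>\<eta>::real. Lim (at_right 0) (\<lambda>\<sigma>::real.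
           ereal (1 / \<eta>\<^sup>2) *
           (SUP (t, x)\<in>{0<..<\<sigma>} \<times> sector (\<eta> * \<theta>) (\<eta> * R). ereal (norm (u t x))))) = 0"
    and "\<epsilon> > 0"
  shows "\<forall>\<^sub>F \<eta> in at_right 0. \<forall>\<^sub>F t in at_right 0. \<forall>x\<in>sector (\<eta> * \<theta>) (\<eta> * R). norm (u t x) \<le> \<epsilon> * \<eta>\<^sup>2"
proof -
  define h where "h = (\<lambda>\<eta> \<sigma>. ereal (1 / \<eta>\<^sup>2) *
      (SUP (t, x)\<in>{0<..<\<sigma>} \<times> sector (\<eta> * \<theta>) (\<eta> * R). ereal (norm (u t x))))"
  have "Limsup (at_right 0) (\<lambda>\<eta>. Lim (at_right 0) (h \<eta>)) < ereal \<epsilon>"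
    using assms by (simp add: h_def)
  then have "\<forall>\<^sub>F \<eta> in at_right 0. Lim (at_right 0) (h \<eta>) < ereal \<epsilon>"
    by (rule Limsup_lessD)
  moreover have "\<forall>\<^sub>F \<eta> in at_right (0::real). 0 < \<eta>" by (simp add: eventually_at_right_less)
  ultimately show ?thesis
  proof eventually_elim
    case (elim \<eta>)
    have mono: "h \<eta> \<sigma> \<le> h \<eta> \<sigma>'" if "\<sigma> \<le> \<sigma>'" for \<sigma> \<sigma>'
      unfolding h_def using that by (intro ereal_mult_left_mono SUP_subset_mono) auto
    have "(h \<eta> \<longlongrightarrow> (INF \<sigma>\<in>{0<..}. h \<eta> \<sigma>)) (at_right 0)"
    proof (rule order_tendstoI)
      fix a assume a: "a < (INF \<sigma>\<in>{0<..}. h \<eta> \<sigma>)"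
      have "\<forall>\<^sub>F \<sigma> in at_right (0::real). 0 < \<sigma>" by (simp add: eventually_at_right_less)
      then show "\<forall>\<^sub>F \<sigma> in at_right 0. a < h \<eta> \<sigma>"
        by eventually_elim (use a in \<open>auto intro: less_le_trans INF_lower\<close>)
    next
      fix a assume "(INF \<sigma>\<in>{0<..}. h \<eta> \<sigma>) < a"
      then obtain \<sigma>0 where "\<sigma>0 > 0" "h \<eta> \<sigma>0 < a" by (auto simp: INF_less_iff)
      then show "\<forall>\<^sub>F \<sigma> in at_right 0. h \<eta> \<sigma> < a"
        unfolding eventually_at_right_field
        by (intro exI[of _ \<sigma>0]) (auto intro: le_less_trans[OF mono[OF less_imp_le]])
    qed
    then have "Lim (at_right 0) (h \<eta>) = (INF \<sigma>\<in>{0<..}. h \<eta> \<sigma>)"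
      by (intro tendsto_Lim) auto
    then have "(INF \<sigma>\<in>{0<..}. h \<eta> \<sigma>) < ereal \<epsilon>" using elim by simp
    then obtain \<sigma> where \<sigma>: "\<sigma> > 0" "h \<eta> \<sigma> < ereal \<epsilon>" by (auto simp: INF_less_iff)
    have "norm (u t x) \<le> \<epsilon> * \<eta>\<^sup>2" if "0 < t" "t < \<sigma>" "x \<in> sector (\<eta> * \<theta>) (\<eta> * R)" for t x
    proof -
      have "ereal (1 / \<eta>\<^sup>2) * ereal (norm (u t x)) \<le> h \<eta> \<sigma>"
        unfolding h_def using that
        by (intro ereal_mult_left_mono SUP_upper2[of "(t, x)"]) auto
      from le_less_trans[OF this \<sigma>(2)] have "1 / \<eta>\<^sup>2 * norm (u t x) < \<epsilon>" by simp
      then show ?thesis using elim by (simp add: field_simps)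
    qed
    then show ?case using \<sigma>(1) unfolding eventually_at_right_field by blast
  qed
qed

text \<open>Restates the Lebesgue integral over the half-open interval as a gauge integral over the
  closed one, for which the fundamental theorem of calculus is applied below. The end point 0 is
  negligible.\<close>

lemma weight_primitive_integral:
  assumes \<mu>: "weight_function T0 \<mu>" and t: "0 < t" "t \<le> T0"
  shows "(\<lambda>s. \<mu> s / s) integrable_on {0..t}" "weight_primitive \<mu> t = integral {0..t} (\<lambda>s. \<mu> s / s)"
proof -
  have "set_integrable lborel {0<..T0} (\<lambda>s. \<mu> s / s)" using \<mu> by (simp add: weight_function_def)
  then have si: "set_integrable lborel {0<..t} (\<lambda>s. \<mu> s / s)"
    by (rule set_integrable_subset) (use t in auto)
  note hk = set_borel_integral_eq_integral[OF si]
  have null: "negligible {x \<in> {0<..t} - {0..t}. \<mu> x / x \<noteq> 0}" "negligible {x \<in> {0..t} - {0<..t}. \<mu> x / x \<noteq> 0}"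
    by (rule negligible_subset[of "{0}"]; force)+
  show "(\<lambda>s. \<mu> s / s) integrable_on {0..t}"
    using integrable_spike_set[OF hk(1) null] .
  show "weight_primitive \<mu> t = integral {0..t} (\<lambda>s. \<mu> s / s)"
    unfolding weight_primitive_def hk(2) using integral_spike_set[OF null] by simp
qed

lemma weight_primitive_nonneg:
  assumes \<mu>: "weight_function T0 \<mu>" and t: "0 < t" "t \<le> T0"
  shows "0 \<le> weight_primitive \<mu> t"
  unfolding weight_primitive_integral(2)[OF assms]
proof (rule integral_nonneg[OF weight_primitive_integral(1)[OF assms]])
  fix s assume "s \<in> {0..t}"
  then show "0 \<le> \<mu> s / s" using \<mu> t by (cases "s = 0") (auto simp: weight_function_def intro!: divide_nonneg_nonneg less_imp_le)
qed

lemma weight_primitive_deriv: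
  assumes \<mu>: "weight_function T0 \<mu>" and t: "0 < t" "t < T0"
  shows "(weight_primitive \<mu> has_real_derivative \<mu> t / t) (at t)"
proof -
  have T0: "0 < T0" using t by simp
  have "continuous_on {0<..T0} (\<lambda>s. \<mu> s / s)"
    using \<mu> by (intro continuous_intros) (auto simp: weight_function_def)
  then have "continuous_on {0<..<T0} (\<lambda>s. \<mu> s / s)"
    by (rule continuous_on_subset) auto
  then have c: "continuous (at t) (\<lambda>s. \<mu> s / s)"
    using t by (simp add: continuous_on_eq_continuous_at)
  have "((\<lambda>x. integral {0..x} (\<lambda>s. \<mu> s / s)) has_vector_derivative \<mu> t / t) (at t within {0..T0} - {})"
    using t T0 c by (intro integral_has_vector_derivative_continuous_at weight_primitive_integral[OF \<mu>])
      (auto intro: continuous_at_imp_continuous_at_within)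
  then have "((\<lambda>x. integral {0..x} (\<lambda>s. \<mu> s / s)) has_vector_derivative \<mu> t / t) (at t within {0<..<T0})"
    by (rule has_vector_derivative_within_subset) auto
  then have "((\<lambda>x. integral {0..x} (\<lambda>s. \<mu> s / s)) has_real_derivative \<mu> t / t) (at t)"
    unfolding has_real_derivative_iff_has_vector_derivative
    by (subst (asm) at_within_open) (use t in auto)
  then show ?thesis
    by (rule has_field_derivative_transform_within_open[of _ _ _ "{0<..<T0}"])
       (use t in \<open>auto simp: weight_primitive_integral(2)[OF \<mu>]\<close>)
qed

lemma weight_primitive_tendsto_0:
  assumes \<mu>: "weight_function T0 \<mu>" and "0 < T0"
  shows "(weight_primitive \<mu> \<longlongrightarrow> 0) (at_right 0)"
proof -
  have "continuous_on {0..T0} (\<lambda>x. integral {0..x} (\<lambda>s. \<mu> s / s))"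
    using assms by (intro indefinite_integral_continuous_1 weight_primitive_integral(1)) auto
  then have "((\<lambda>x. integral {0..x} (\<lambda>s. \<mu> s / s)) \<longlongrightarrow> integral {0..0} (\<lambda>s. \<mu> s / s)) (at 0 within {0..T0})"
    unfolding continuous_on_def by (rule bspec) (use assms in auto)
  then have "((\<lambda>x. integral {0..x} (\<lambda>s. \<mu> s / s)) \<longlongrightarrow> 0) (at_right 0)"
    using assms by (simp add: at_within_Icc_at_right)
  moreover have "\<forall>\<^sub>F t in at_right 0. integral {0..t} (\<lambda>s. \<mu> s / s) = weight_primitive \<mu> t"
    using eventually_at_right_real[OF assms(2)]
    by eventually_elim (simp add: weight_primitive_integral(2)[OF \<mu>])
  ultimately show ?thesis by (rule Lim_transform_eventually)
qed

text \<open>By the mean value theorem and monotonicity, the increase of the primitive over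
  \<open>[t, 2 * t]\<close> is at least \<open>t * (\<mu> t / (2 * t)) = \<mu> t / 2\<close>, and
  the primitive tends to 0.\<close>

lemma weight_tendsto_0:
  assumes \<mu>: "weight_function T0 \<mu>" and "0 < T0"
  shows "(\<mu> \<longlongrightarrow> 0) (at_right 0)"
proof (rule tendsto_sandwich[where f = "\<lambda>_. 0" and h = "\<lambda>t. 2 * weight_primitive \<mu> (2 * t)"])
  have two: "filterlim (\<lambda>t::real. 2 * t) (at_right 0) (at_right 0)"
    unfolding filterlim_at_right_to_0[symmetric] filterlim_at
    by (auto intro!: tendsto_eq_intros simp: eventually_at_filter)
  show "((\<lambda>t. 2 * weight_primitive \<mu> (2 * t)) \<longlongrightarrow> 0) (at_right 0)"
    using tendsto_mult_right_zero[OF filterlim_compose[OF weight_primitive_tendsto_0[OF assms] two]] by simp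
  have ev: "\<forall>\<^sub>F t in at_right 0. t \<in> {0<..<T0 / 2}" using assms by (intro eventually_at_right_real) auto
  then show "\<forall>\<^sub>F t in at_right 0. \<mu> t \<le> 2 * weight_primitive \<mu> (2 * t)"
  proof eventually_elim
    case (elim t)
    then have "\<exists>z. t < z \<and> z < 2 * t \<and> weight_primitive \<mu> (2 * t) - weight_primitive \<mu> t = (2 * t - t) * (\<mu> z / z)"
      by (intro MVT2 weight_primitive_deriv[OF \<mu>]) auto
    then obtain z where z: "t < z" "z < 2 * t" "weight_primitive \<mu> (2 * t) - weight_primitive \<mu> t = t * (\<mu> z / z)" by auto
    have "\<mu> t \<le> \<mu> z" "\<mu> t > 0"
      using \<mu> z elim by (auto simp: weight_function_def intro: mono_onD)
    then have "\<mu> t / (2 * t) \<le> \<mu> z / z" using z elim by (intro frac_le) auto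
    then have "t * (\<mu> t / (2 * t)) \<le> t * (\<mu> z / z)" using elim by (intro mult_left_mono) auto
    moreover have "t * (\<mu> t / (2 * t)) = \<mu> t / 2" using elim by simp
    moreover have "0 \<le> weight_primitive \<mu> t" using elim by (intro weight_primitive_nonneg[OF \<mu>]) auto
    ultimately show ?case using z(3) by linarith
  qed
  from ev show "\<forall>\<^sub>F t in at_right 0. 0 \<le> \<mu> t"
    by eventually_elim (use \<mu> in \<open>auto simp: weight_function_def intro!: less_imp_le\<close>)
qed simp

section \<open>Logarithmic coordinates\<close>

text \<open>For \<open>\<theta> \<le> pi\<close> the strict bound on \<open>Arg\<close> excludes the
  negative real axis, off which \<open>Arg\<close> is continuous.\<close>

lemma open_sector:
  assumes "\<theta> \<le> pi"
  shows "open (sector \<theta> R)"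
proof -
  have eq: "sector \<theta> R = ((- \<real>\<^sub>\<le>\<^sub>0) \<inter> Arg -` {- \<theta><..<\<theta>}) \<inter> ball 0 R"
  proof (intro equalityI subsetI)
    fix x assume x: "x \<in> sector \<theta> R"
    have "x \<notin> \<real>\<^sub>\<le>\<^sub>0"
    proof
      assume "x \<in> \<real>\<^sub>\<le>\<^sub>0"
      then have "Im x = 0" "Re x \<le> 0" by (auto simp: complex_nonpos_Reals_iff)
      moreover have "x \<noteq> 0" using x by (auto simp: sector_def)
      ultimately have "Arg x = pi" using complex_eqI[of x 0] by (auto simp: Arg_eq_pi less_le)
      then show False using x assms by (simp add: sector_def)
    qed
    then show "x \<in> ((- \<real>\<^sub>\<le>\<^sub>0) \<inter> Arg -` {- \<theta><..<\<theta>}) \<inter> ball 0 R"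
      using x by (auto simp: sector_def)
  next
    fix x assume x: "x \<in> ((- \<real>\<^sub>\<le>\<^sub>0) \<inter> Arg -` {- \<theta><..<\<theta>}) \<inter> ball 0 R"
    then have "x \<noteq> 0" by auto
    with x show "x \<in> sector \<theta> R" by (auto simp: sector_def)
  qed
  have "continuous_on (- \<real>\<^sub>\<le>\<^sub>0) Arg"
    by (intro continuous_at_imp_continuous_on ballI continuous_at_Arg) auto
  then have "open ((- \<real>\<^sub>\<le>\<^sub>0) \<inter> Arg -` {- \<theta><..<\<theta>})"
    by (intro continuous_open_preimage) (auto simp: closed_nonpos_Reals_complex open_Compl)
  then show ?thesis unfolding eq by (rule open_Int[OF _ open_ball])
qed

lemma exp_in_sector:
  assumes "Re y < L" "\<bar>Im y\<bar> < \<theta>" "\<theta> \<le> pi"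
  shows "exp y \<in> sector \<theta> (exp L)"
  using assms by (simp add: sector_def Arg_exp)

text \<open>The last claim is the derivative along the backward direction \<open>(- 1, b)\<close>,
  written with the two derivatives that occur in \<open>solves_E\<close>, so that the equation can
  be inserted directly.\<close>

lemma log_coordinates:
  fixes u :: "real \<Rightarrow> complex \<Rightarrow> complex" and L \<Theta> \<tau>m :: real
  defines "U \<equiv> (\<lambda>\<tau> y. u (exp \<tau>) (exp y))" and "S \<equiv> {y. Re y < L \<and> \<bar>Im y\<bar> < \<Theta>}"
  assumes u: "u \<in> X1 Wd" and \<Theta>: "\<Theta> \<le> pi"
    and dom: "exp ` {..<\<tau>m} \<times> sector \<Theta> (exp L) \<subseteq> Wd"
  shows "continuous_on ({..<\<tau>m} \<times> S) (\<lambda>(\<tau>, y). U \<tau> y)"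
    and "\<tau> < \<tau>m \<Longrightarrow> U \<tau> holomorphic_on S"
    and "\<tau> < \<tau>m \<Longrightarrow> y \<in> S \<Longrightarrow> (U \<tau> has_field_derivative exp y * deriv (u (exp \<tau>)) (exp y)) (at y)"
    and "\<tau> < \<tau>m \<Longrightarrow> y \<in> S \<Longrightarrow> ((\<lambda>e. U (\<tau> - e) (y + of_real e * b)) has_vector_derivative
       b * (exp y * deriv (u (exp \<tau>)) (exp y))
       - of_real (exp \<tau>) * vector_derivative (\<lambda>s. u s (exp y)) (at (exp \<tau>))) (at 0)"
proof -
  have sub: "(exp \<tau>, x) \<in> Wd" if "\<tau> < \<tau>m" "x \<in> sector \<Theta> (exp L)" for \<tau> x
    using that dom by auto
  obtain F :: "real \<times> complex \<Rightarrow> (real \<times> complex) \<Rightarrow>\<^sub>L complex"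
    where F: "\<And>z. z \<in> Wd \<Longrightarrow> ((\<lambda>(t, x). u t x) has_derivative blinfun_apply (F z)) (at z)"
    using u by (auto simp: X1_def C1_on_def)
  have hol: "u (exp \<tau>) holomorphic_on sector \<Theta> (exp L)" if "\<tau> < \<tau>m" for \<tau>
  proof -
    have "u (exp \<tau>) holomorphic_on {x. (exp \<tau>, x) \<in> Wd}" using u by (simp add: X1_def)
    then show ?thesis by (rule holomorphic_on_subset) (use sub that in auto)
  qed
  have inS: "exp y \<in> sector \<Theta> (exp L)" if "y \<in> S" for y
    using that \<Theta> by (auto simp: S_def intro: exp_in_sector)
  have fd: "(u (exp \<tau>) has_field_derivative deriv (u (exp \<tau>)) (exp y)) (at (exp y))"
    if "\<tau> < \<tau>m" "y \<in> S" for \<tau> y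
    by (rule holomorphic_derivI[OF hol[OF that(1)] open_sector[OF \<Theta>] inS[OF that(2)]])
  have Ud: "(U \<tau> has_field_derivative exp y * deriv (u (exp \<tau>)) (exp y)) (at y)"
    if "\<tau> < \<tau>m" "y \<in> S" for \<tau> y
    using DERIV_chain2[OF fd[OF that] DERIV_exp] unfolding U_def by (simp add: mult.commute)
  then show "\<tau> < \<tau>m \<Longrightarrow> y \<in> S \<Longrightarrow> (U \<tau> has_field_derivative exp y * deriv (u (exp \<tau>)) (exp y)) (at y)" .
  show "\<tau> < \<tau>m \<Longrightarrow> U \<tau> holomorphic_on S"
    unfolding holomorphic_on_def
    using Ud by (meson field_differentiable_at_within field_differentiable_def)
  show "continuous_on ({..<\<tau>m} \<times> S) (\<lambda>(\<tau>, y). U \<tau> y)"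
  proof -
    have "continuous_on Wd (\<lambda>(t, x). u t x)"
      using F by (intro continuous_at_imp_continuous_on ballI has_derivative_continuous) blast
    then have "continuous_on ({..<\<tau>m} \<times> S) (\<lambda>z. (\<lambda>(t, x). u t x) (exp (fst z), exp (snd z)))"
      by (rule continuous_on_compose2) (auto intro!: continuous_intros sub inS)
    then show ?thesis by (simp add: U_def case_prod_unfold)
  qed
  show "((\<lambda>e. U (\<tau> - e) (y + of_real e * b)) has_vector_derivative
       b * (exp y * deriv (u (exp \<tau>)) (exp y))
       - of_real (exp \<tau>) * vector_derivative (\<lambda>s. u s (exp y)) (at (exp \<tau>))) (at 0)"
    if ty: "\<tau> < \<tau>m" "y \<in> S"
  proof -
    define t x where "t = exp \<tau>" and "x = exp y"
    have Fz: "((\<lambda>(t, x). u t x) has_derivative blinfun_apply (F (t, x))) (at (t, x))"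
      using sub[OF ty(1) inS[OF ty(2)]] by (intro F) (simp add: t_def x_def)
    have "((\<lambda>s. (s, x)) has_derivative (\<lambda>h. (h, 0))) (at t)"
      by (auto intro!: derivative_eq_intros)
    from has_derivative_compose[OF this Fz]
    have "((\<lambda>s. u s x) has_derivative (\<lambda>h. blinfun_apply (F (t, x)) (h, 0))) (at t)" by simp
    moreover have "(\<lambda>h. blinfun_apply (F (t, x)) (h, 0)) = (\<lambda>h. h *\<^sub>R blinfun_apply (F (t, x)) (1, 0))"
      by (simp add: fun_eq_iff flip: blinfun.scaleR_right)
    ultimately have "((\<lambda>s. u s x) has_vector_derivative blinfun_apply (F (t, x)) (1, 0)) (at t)"
      by (simp only: has_vector_derivative_def)
    then have Ft: "vector_derivative (\<lambda>s. u s x) (at t) = blinfun_apply (F (t, x)) (1, 0)"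
      by (rule vector_derivative_at)
    have "((\<lambda>s. (t, s)) has_derivative (\<lambda>h. (0, h))) (at x)"
      by (auto intro!: derivative_eq_intros)
    from has_derivative_compose[OF this Fz]
    have "((\<lambda>s. u t s) has_derivative (\<lambda>h. blinfun_apply (F (t, x)) (0, h))) (at x)" by simp
    moreover have "(u t has_derivative (*) (deriv (u t) x)) (at x)"
      using fd[OF ty] unfolding has_field_derivative_def t_def x_def .
    \<comment> \<open>Uniqueness of derivatives identifies the spatial part of the real Frechet
      derivative with multiplication by the complex derivative.\<close>
    ultimately have Fx: "(\<lambda>h. blinfun_apply (F (t, x)) (0, h)) = (*) (deriv (u t) x)"
      by (rule has_derivative_unique)
    have "((\<lambda>e. (exp (\<tau> - e), exp (y + of_real e * b))) has_derivative (\<lambda>h. (- (h * t), of_real h * (b * x)))) (at 0)"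
    proof (intro has_derivative_Pair)
      show "((\<lambda>e. exp (\<tau> - e)) has_derivative (\<lambda>h. - (h * t))) (at 0)"
        by (auto intro!: derivative_eq_intros simp: t_def)
      have "((\<lambda>e. y + of_real e * b) has_vector_derivative b) (at 0)"
        unfolding has_vector_derivative_def by (auto intro!: derivative_eq_intros simp: scaleR_conv_of_real)
      from field_vector_diff_chain_at[OF this DERIV_exp]
      show "((\<lambda>e. exp (y + of_real e * b)) has_derivative (\<lambda>h. of_real h * (b * x))) (at 0)"
        by (simp add: has_vector_derivative_def o_def x_def scaleR_conv_of_real)
    qed
    moreover have "((\<lambda>(t, x). u t x) has_derivative blinfun_apply (F (t, x))) (at (exp (\<tau> - 0), exp (y + of_real 0 * b)))"
      using Fz by (simp add: t_def x_def)
    ultimately have "((\<lambda>e. (\<lambda>(t, x). u t x) (exp (\<tau> - e), exp (y + of_real e * b))) has_derivative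
        (\<lambda>h. blinfun_apply (F (t, x)) (- (h * t), of_real h * (b * x)))) (at 0)"
      by (rule has_derivative_compose)
    then have "((\<lambda>e. u (exp (\<tau> - e)) (exp (y + of_real e * b))) has_derivative
        (\<lambda>h. blinfun_apply (F (t, x)) (- (h * t), of_real h * (b * x)))) (at 0)"
      by simp
    moreover have "blinfun_apply (F (t, x)) (- (h * t), of_real h * (b * x))
        = h *\<^sub>R (b * (x * deriv (u t) x) - of_real t * vector_derivative (\<lambda>s. u s x) (at t))" for h
    proof -
      have "(- (h * t), of_real h * (b * x)) = (- (h * t)) *\<^sub>R (1, 0) + (0, of_real h * (b * x))" by simp
      then have "blinfun_apply (F (t, x)) (- (h * t), of_real h * (b * x))
          = (- (h * t)) *\<^sub>R blinfun_apply (F (t, x)) (1, 0) + blinfun_apply (F (t, x)) (0, of_real h * (b * x))"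
        by (simp only: blinfun.add_right blinfun.scaleR_right)
      then show ?thesis using fun_cong[OF Fx, of "of_real h * (b * x)"] Ft
        by (simp add: scaleR_conv_of_real algebra_simps)
    qed
    ultimately show ?thesis
      unfolding has_vector_derivative_def U_def t_def x_def by simp
  qed
qed

text \<open>Turns the Lipschitz estimate for the remainder into linear terms with small
  coefficients. With \<open>s = norm w + norm v\<close> the coefficients are
  \<open>\<Delta> / s\<close> times the conjugate signs of \<open>w\<close> and \<open>v\<close>,
  because \<open>cnj (sgn z) * z\<close> is the modulus of \<open>z\<close>. The maximum principle
  asks for such coefficients only point by point.\<close>

lemma split_coefficients:
  fixes \<Delta> w v :: complex
  assumes "norm \<Delta> \<le> K * (norm w + norm v)" "K \<ge> 0"
  shows "\<exists>A B. \<Delta> = A * w + B * v \<and> norm A \<le> K \<and> norm B \<le> K"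
proof (cases "norm w + norm v = 0")
  case True
  then have "\<Delta> = 0" using assms by simp
  then show ?thesis using assms by (intro exI[of _ 0]) simp
next
  case False
  define s where "s = norm w + norm v"
  have s: "s > 0" using False norm_ge_zero[of w] norm_ge_zero[of v] unfolding s_def by linarith
  have sgn: "cnj (sgn z) * z = of_real (norm z)" for z :: complex
  proof (cases "z = 0")
    case False
    have "cnj (sgn z) * z = (z * cnj z) / of_real (norm z)" by (simp add: sgn_eq mult.commute)
    also have "\<dots> = of_real (norm z)" using False by (simp add: complex_norm_square[symmetric] power2_eq_square)
    finally show ?thesis .
  qed simp
  have le: "norm (\<Delta> / of_real s * cnj (sgn z)) \<le> K" for z
  proof -
    have "norm (\<Delta> / of_real s) \<le> K"
      using assms s by (simp add: norm_divide s_def[symmetric] pos_divide_le_eq)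
    moreover have "norm (cnj (sgn z)) \<le> 1" by (simp add: norm_sgn)
    ultimately have "norm (\<Delta> / of_real s) * norm (cnj (sgn z)) \<le> K * 1"
      using assms by (intro mult_mono) auto
    then show ?thesis unfolding norm_mult by simp
  qed
  have "\<Delta> / of_real s * cnj (sgn w) * w + \<Delta> / of_real s * cnj (sgn v) * v
      = \<Delta> / of_real s * (cnj (sgn w) * w + cnj (sgn v) * v)" by (simp add: algebra_simps)
  also have "\<dots> = \<Delta>" using s unfolding sgn by (simp add: s_def flip: of_real_add)
  finally show ?thesis using le by metis
qed

lemma cos_ge_half: "\<bar>x\<bar> \<le> 1 \<Longrightarrow> 1 / 2 \<le> cos x" for x :: real
proof -
  assume "\<bar>x\<bar> \<le> 1"
  then have "cos (pi / 3) \<le> cos \<bar>x\<bar>" using pi_gt3 by (intro cos_monotone_0_pi_le) auto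
  then show ?thesis by (simp add: cos_60)
qed

lemma sin_ge_half: "0 \<le> x \<Longrightarrow> x \<le> 1 \<Longrightarrow> x / 2 \<le> sin x" for x :: real
proof (cases "x = 0")
  case False
  assume x: "0 \<le> x" "x \<le> 1"
  then obtain z where z: "0 < z" "z < x" "sin x - sin 0 = (x - 0) * cos z"
    using MVT2[of 0 x sin cos] False by (auto intro: DERIV_sin)
  have "x * (1 / 2) \<le> x * cos z" using x z by (intro mult_left_mono cos_ge_half) auto
  then show ?thesis using z by simp
qed simp

text \<open>The leading part of the drift is \<open>- \<gamma> * exp (p * y)\<close>, whose argument
  is governed by \<open>p * Im y\<close>. This angle is at most 1 in modulus, so the leading real
  part is negative; for \<open>\<bar>Im y\<bar> \<ge> \<Theta> / 2\<close> the imaginary part points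
  towards the real axis. In both cases its size, relative to the modulus of
  \<open>exp y ^ p\<close>, is at least the error \<open>\<gamma> * \<Theta> / 4\<close>.\<close>

lemma power_drift_inward:
  fixes y d :: complex and \<gamma> \<Theta> :: real
  assumes p: "p \<ge> 1" and \<gamma>: "\<gamma> > 0" and \<Theta>: "0 < \<Theta>" "\<Theta> \<le> 1" "real p * \<Theta> \<le> 1"
    and y: "\<bar>Im y\<bar> \<le> \<Theta>" and d: "norm (d + of_real \<gamma>) \<le> \<gamma> * \<Theta> / 4"
  shows "Re (exp y ^ p * d) \<le> 0" "\<Theta> / 2 \<le> Im y \<Longrightarrow> Im (exp y ^ p * d) \<le> 0"
    "\<Theta> / 2 \<le> - Im y \<Longrightarrow> 0 \<le> Im (exp y ^ p * d)"
proof -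
  define \<phi> where "\<phi> = real p * Im y"
  define e where "e = cis \<phi> * (d + of_real \<gamma>)"
  have e: "norm e \<le> \<gamma> * \<Theta> / 4" using d by (simp add: e_def norm_mult)
  have "exp y ^ p = exp (of_nat p * y)" by (simp add: exp_of_nat_mult)
  also have "\<dots> = of_real (exp (real p * Re y)) * cis \<phi>"
    by (simp add: exp_eq_polar \<phi>_def)
  finally have eq: "exp y ^ p * d = of_real (exp (real p * Re y)) * (e - of_real \<gamma> * cis \<phi>)"
    by (simp add: e_def algebra_simps)
  have Re: "Re (exp y ^ p * d) = exp (real p * Re y) * (Re e - \<gamma> * cos \<phi>)"
    and Im: "Im (exp y ^ p * d) = exp (real p * Re y) * (Im e - \<gamma> * sin \<phi>)"
    unfolding eq by simp_all
  have \<phi>: "\<bar>\<phi>\<bar> \<le> 1"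
  proof -
    have "\<bar>\<phi>\<bar> = real p * \<bar>Im y\<bar>" by (simp add: \<phi>_def abs_mult)
    also have "\<dots> \<le> real p * \<Theta>" using y by (intro mult_left_mono) auto
    finally show ?thesis using \<Theta> by simp
  qed
  have "\<gamma> * (1 / 2) \<le> \<gamma> * cos \<phi>" using \<gamma> \<phi> by (intro mult_left_mono cos_ge_half) auto
  moreover have "\<gamma> * \<Theta> \<le> \<gamma> * 1" using \<gamma> \<Theta> by (intro mult_left_mono) auto
  moreover have "Re e \<le> \<gamma> * \<Theta> / 4" using e complex_Re_le_cmod[of e] by linarith
  ultimately have "Re e - \<gamma> * cos \<phi> \<le> 0" using \<gamma> by linarith
  then show "Re (exp y ^ p * d) \<le> 0" unfolding Re by (simp add: mult_nonneg_nonpos)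
  have Ime: "\<bar>Im e\<bar> \<le> \<gamma> * \<Theta> / 4" using e abs_Im_le_cmod[of e] by linarith
  have p1: "a \<le> real p * a" if "a \<ge> 0" for a
    using p that mult_right_mono[of 1 "real p" a] by simp
  show "Im (exp y ^ p * d) \<le> 0" if "\<Theta> / 2 \<le> Im y"
  proof -
    have "\<Theta> / 2 \<le> \<phi>" using p1[of "Im y"] that \<Theta> unfolding \<phi>_def by linarith
    then have "\<Theta> / 4 \<le> sin \<phi>" using sin_ge_half[of \<phi>] \<phi> \<Theta> by simp
    then have "\<gamma> * (\<Theta> / 4) \<le> \<gamma> * sin \<phi>" using \<gamma> by (intro mult_left_mono) auto
    then have "Im e - \<gamma> * sin \<phi> \<le> 0" using Ime by simp
    then show ?thesis unfolding Im by (simp add: mult_nonneg_nonpos)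
  qed
  show "0 \<le> Im (exp y ^ p * d)" if "\<Theta> / 2 \<le> - Im y"
  proof -
    have "\<Theta> / 2 \<le> - \<phi>" using p1[of "- Im y"] that \<Theta> unfolding \<phi>_def mult_minus_right by linarith
    then have "\<Theta> / 4 \<le> - sin \<phi>" using sin_ge_half[of "- \<phi>"] \<phi> \<Theta> by simp
    then have "\<gamma> * (\<Theta> / 4) \<le> \<gamma> * - sin \<phi>" using \<gamma> by (intro mult_left_mono) auto
    then have "0 \<le> Im e - \<gamma> * sin \<phi>" using Ime by simp
    then show ?thesis unfolding Im by simp
  qed
qed

section \<open>Uniqueness\<close>

theorem theorem4p2:
  fixes p :: nat
    and T0 R0 \<rho>0 :: real
    and \<alpha> lam \<beta> c :: "real \<Rightarrow> complex \<Rightarrow> complex"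
    and R2 :: "real \<Rightarrow> complex \<Rightarrow> complex \<Rightarrow> complex \<Rightarrow> complex"
    and \<mu> :: "real \<Rightarrow> real"
    and Ts Rs \<theta>s rs :: real
    and u0 :: "real \<Rightarrow> complex \<Rightarrow> complex"
    and T R \<theta> :: real
    and u :: "real \<Rightarrow> complex \<Rightarrow> complex"
  assumes "p \<ge> 1"
    and "T0 > 0" and "R0 > 0" and "\<rho>0 > 0"
    and "coefficient_function T0 R0 \<alpha>"
    and "coefficient_function T0 R0 lam"
    and "coefficient_function T0 R0 \<beta>"
    and "coefficient_function T0 R0 c"
    and "remainder_function T0 R0 \<rho>0 R2"
    and "weight_function T0 \<mu>"
    and "sup_bigo R0 \<alpha> \<mu>"
    and "sup_bigo R0 \<beta> \<mu>"
    and "c 0 0 \<in> \<real>" and "Re (c 0 0) < 0"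
    and "Re (lam 0 0) < 0"
    and "0 < Ts" and "Ts \<le> T0" and "Rs > 0" and "0 < \<theta>s" and "\<theta>s < pi / (2 * real p)" and "rs > 0"
    and "unique_bounded_solution T0 R0 \<rho>0 p \<alpha> lam \<beta> c R2 \<mu> (W_domain \<mu> Ts Rs \<theta>s rs) u0"
    and "T > 0" and "\<theta> > 0" and "R > 0"
    and "u \<in> X1 ({0<..<T} \<times> sector \<theta> R)"
    and "solves_E T0 R0 \<rho>0 p \<alpha> lam \<beta> c R2 ({0<..<T} \<times> sector \<theta> R) u"
    and "Limsup (at_right 0) (\<lambda>\<eta>::real. Lim (at_right 0) (\<lambda>\<sigma>::real.
           ereal (1 / \<eta>\<^sup>2) *
           (SUP (t, x)\<in>{0<..<\<sigma>} \<times> sector (\<eta> * \<theta>) (\<eta> * R). ereal (norm (u t x))))) = 0"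
  shows "\<exists>T1>0. \<exists>\<theta>1>0. \<exists>R1>0.
           {0<..<T1} \<times> sector \<theta>1 R1 \<subseteq> ({0<..<T} \<times> sector \<theta> R) \<inter> W_domain \<mu> Ts Rs \<theta>s rs \<and>
           (\<forall>t\<in>{0<..<T1}. \<forall>x\<in>sector \<theta>1 R1. u t x = u0 t x)"
proof -

  \<comment> \<open>Constants independent of the opening \<open>\<eta>\<close>\<close>
  note T0 = \<open>T0 > 0\<close> and R0 = \<open>R0 > 0\<close> and \<mu> = \<open>weight_function T0 \<mu>\<close>
  let ?W = "W_domain \<mu> Ts Rs \<theta>s rs"
  let ?\<phi> = "weight_primitive \<mu>"
  have u0: "u0 \<in> X1 ?W" "solves_E T0 R0 \<rho>0 p \<alpha> lam \<beta> c R2 ?W u0" "mu_bounded \<mu> ?W u0"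
    using assms(22) by (auto simp: unique_bounded_solution_def Let_def)
  obtain M where M: "M > 0" "\<And>t x. (t, x) \<in> ?W \<Longrightarrow> norm (u0 t x) \<le> M * \<mu> t"
    "\<And>t x. (t, x) \<in> ?W \<Longrightarrow> norm (x * deriv (u0 t) x) \<le> M * \<mu> t"
    using u0(3) unfolding mu_bounded_def by fast
  obtain C1 r where C1: "C1 \<ge> 0" and r: "r > 0"
    and R2_lip: "\<And>t x m u v u' v'. t \<in> {0..T0} \<Longrightarrow> norm x \<le> R0 / 2 \<Longrightarrow> m \<le> r \<Longrightarrow>
      norm u \<le> m \<Longrightarrow> norm v \<le> m \<Longrightarrow> norm u' \<le> m \<Longrightarrow> norm v' \<le> m \<Longrightarrow>
      norm (R2 t x u v - R2 t x u' v') \<le> C1 * m * (norm (u - u') + norm (v - v'))"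
    using remainder_lipschitz[OF assms(9) R0 \<open>\<rho>0 > 0\<close>] by metis
  obtain C\<beta> where C\<beta>: "C\<beta> \<ge> 0" "\<forall>\<^sub>F t in at_right 0. \<forall>x\<in>ball 0 R0. norm (\<beta> t x) \<le> C\<beta> * \<bar>\<mu> t\<bar>"
    using sup_bigo_pointwise[OF assms(12)] by blast
  obtain Kc where Kc: "Kc \<ge> 0" "\<And>\<kappa>. \<kappa> > 0 \<Longrightarrow>
      \<forall>\<^sub>F t in at_right 0. \<forall>x\<in>ball 0 (R0 / 4). norm (c t x - c 0 0) \<le> Kc * norm x + \<kappa>"
    using coefficient_near_origin[OF assms(8) T0 R0] by blast
  obtain Kl where Kl: "Kl \<ge> 0" "\<And>\<kappa>. \<kappa> > 0 \<Longrightarrow>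
      \<forall>\<^sub>F t in at_right 0. \<forall>x\<in>ball 0 (R0 / 4). norm (lam t x - lam 0 0) \<le> Kl * norm x + \<kappa>"
    using coefficient_near_origin[OF assms(6) T0 R0] by blast
  define \<gamma> where "\<gamma> = - Re (c 0 0)"
  have \<gamma>: "\<gamma> > 0" "c 0 0 = - of_real \<gamma>"
    using assms(13,14) by (auto simp: \<gamma>_def complex_eq_iff complex_is_Real_iff)
  \<comment> \<open>With \<open>Re (lam 0 0) = - 4 * a0\<close>, one \<open>a0\<close> is spent on
    the variation of \<open>lam\<close> and one on the remainder, which leaves the rate
    \<open>- 2 * a0\<close>.\<close>
  define a0 where "a0 = - Re (lam 0 0) / 4"
  have a0: "a0 > 0" using assms(15) by (simp add: a0_def)
  define q where "q = exp (- a0 / 2)"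
  have q: "q < 1" using a0 by (simp add: q_def)
  \<comment> \<open>The first entry keeps all arguments of \<open>R2\<close> within the Lipschitz
    radius \<open>r\<close>; the second makes the coefficients split off from the remainder at most
    \<open>a0\<close>.\<close>
  define k0 where "k0 = min (r / 2) (a0 / (2 * (C1 + 1)))"
  have k0: "k0 > 0" "2 * k0 \<le> r" using r a0 C1 by (auto simp: k0_def)
  have C1k0: "C1 * (2 * k0) \<le> a0"
  proof -
    have "k0 * (2 * (C1 + 1)) \<le> a0"
      using C1 pos_le_divide_eq[of "2 * (C1 + 1)" k0 a0] by (simp add: k0_def)
    then show ?thesis using k0 by (simp add: algebra_simps)
  qed
  \<comment> \<open>The entries with \<open>Kc\<close> and \<open>Kl\<close> limit the variation of
    \<open>c\<close> and \<open>lam\<close> in \<open>x\<close>; the last one ensures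
    \<open>ln (Rs / norm x) > \<theta>s / 2\<close>, as membership in the domain of
    \<open>u0\<close> requires.\<close>
  let ?radii = "{R, 1, R0 / 8, \<gamma> * \<theta> / (8 * (Kc + 1)), a0 / (2 * (Kl + 1)), Rs * exp (- \<theta>s / 2)}"
  define R' where "R' = Min ?radii"
  have "\<forall>y\<in>?radii. 0 < y"
    using \<gamma> a0 Kc(1) Kl(1) R0 \<open>R > 0\<close> \<open>\<theta> > 0\<close> \<open>Rs > 0\<close> by (simp add: add_nonneg_pos)
  then have "R' > 0" unfolding R'_def by (subst Min_gr_iff) auto
  moreover have "R' \<le> y" if "y \<in> ?radii" for y
    unfolding R'_def using that by (intro Min_le) auto
  ultimately have R': "R' > 0" "R' \<le> R" "R' \<le> 1" "R' \<le> R0 / 8" "R' \<le> Rs * exp (- \<theta>s / 2)"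
    "R' \<le> \<gamma> * \<theta> / (8 * (Kc + 1))" "R' \<le> a0 / (2 * (Kl + 1))"
    by blast+
  have KcR': "Kc * R' \<le> \<gamma> * \<theta> / 8"
  proof -
    have "R' * (8 * (Kc + 1)) \<le> \<gamma> * \<theta>" using R'(6) Kc(1) by (subst (asm) pos_le_divide_eq) auto
    then show ?thesis using R'(1) by (simp add: algebra_simps)
  qed
  have KlR': "Kl * R' \<le> a0 / 2"
  proof -
    have "R' * (2 * (Kl + 1)) \<le> a0" using R'(7) Kl(1) by (subst (asm) pos_le_divide_eq) auto
    then show ?thesis using R'(1) by (simp add: algebra_simps)
  qed
  \<comment> \<open>The last entry bounds the total geometric loss by \<open>\<theta> / 8\<close>;
    scaled by \<open>\<eta>\<close> it becomes an eighth of the new opening.\<close>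
  define e1 where "e1 = Min {1, k0 / 2, \<theta> * (1 - q) / (8 * (1 + 2 * C1))}"
  have e1: "e1 > 0" "e1 \<le> 1" "2 * e1 \<le> k0" "e1 \<le> \<theta> * (1 - q) / (8 * (1 + 2 * C1))"
    using k0 C1 q \<open>\<theta> > 0\<close> by (auto simp: e1_def)
  have e1': "(1 + 2 * C1) * e1 / (1 - q) \<le> \<theta> / 8"
  proof -
    have "e1 * (8 * (1 + 2 * C1)) \<le> \<theta> * (1 - q)" using e1(4) C1 by (subst (asm) pos_le_divide_eq) auto
    then show ?thesis using q by (simp add: pos_divide_le_eq algebra_simps)
  qed

  \<comment> \<open>Choice of the opening from the smallness of \<open>u\<close>\<close>
  have "\<forall>\<^sub>F \<eta> in at_right 0. \<forall>\<^sub>F t in at_right 0. \<forall>x\<in>sector (\<eta> * \<theta>) (\<eta> * R). norm (u t x) \<le> (e1\<^sup>2 / 2) * \<eta>\<^sup>2"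
    using e1 by (intro limsup_smallness[OF assms(28)]) auto
  moreover have "\<forall>\<^sub>F \<eta> in at_right 0. \<eta> \<in> {0<..<Min {1, 1 / \<theta>, 1 / (real p * \<theta>), \<theta>s / (2 * \<theta>)}}"
    using \<open>\<theta> > 0\<close> \<open>\<theta>s > 0\<close> \<open>p \<ge> 1\<close> by (intro eventually_at_right_real) auto
  ultimately have "\<forall>\<^sub>F \<eta> in at_right (0::real). \<eta> \<in> {0<..<Min {1, 1 / \<theta>, 1 / (real p * \<theta>), \<theta>s / (2 * \<theta>)}} \<and>
     (\<forall>\<^sub>F t in at_right 0. \<forall>x\<in>sector (\<eta> * \<theta>) (\<eta> * R). norm (u t x) \<le> (e1\<^sup>2 / 2) * \<eta>\<^sup>2)"
    by eventually_elim simp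
  from eventually_happens'[OF trivial_limit_at_right_real this] obtain \<eta>
    where "\<eta> \<in> {0<..<Min {1, 1 / \<theta>, 1 / (real p * \<theta>), \<theta>s / (2 * \<theta>)}} \<and>
      (\<forall>\<^sub>F t in at_right 0. \<forall>x\<in>sector (\<eta> * \<theta>) (\<eta> * R). norm (u t x) \<le> (e1\<^sup>2 / 2) * \<eta>\<^sup>2)" ..
  then have \<eta>_in: "\<eta> \<in> {0<..<Min {1, 1 / \<theta>, 1 / (real p * \<theta>), \<theta>s / (2 * \<theta>)}}"
    and u_small: "\<forall>\<^sub>F t in at_right 0. \<forall>x\<in>sector (\<eta> * \<theta>) (\<eta> * R). norm (u t x) \<le> (e1\<^sup>2 / 2) * \<eta>\<^sup>2"
    by (rule conjunct1, rule conjunct2)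
  define \<Theta> where "\<Theta> = \<eta> * \<theta>"
  have \<eta>: "0 < \<eta>" "\<eta> \<le> 1" "0 < \<Theta>" "\<Theta> \<le> 1" "real p * \<Theta> \<le> 1" "\<Theta> \<le> \<theta>s / 2"
    using \<eta>_in \<open>\<theta> > 0\<close> \<open>p \<ge> 1\<close> by (auto simp: \<Theta>_def field_simps)
  \<comment> \<open>The radius shrinks with \<open>\<eta>\<close> as well, so the variation of
    \<open>c\<close> in \<open>x\<close> is at most \<open>\<gamma> * \<Theta> / 8\<close>, as the
    inward drift requires.\<close>
  define L where "L = ln (\<eta> * R')"
  have expL: "exp L = \<eta> * R'" using \<eta> R' by (simp add: L_def)
  have expL_le: "exp L \<le> R'" using \<eta> R' by (simp add: expL mult_le_cancel_right1)
  \<comment> \<open>The bound obtained for \<open>u\<close> is \<open>\<nu>0\<^sup>2 / 2\<close>;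
    the other half is reserved for \<open>u0\<close>.\<close>
  define \<nu>0 where "\<nu>0 = e1 * \<eta>"
  have \<nu>0: "\<nu>0 > 0" "\<nu>0 \<le> e1" using e1 \<eta> by (auto simp: \<nu>0_def mult_le_cancel_left1)
  \<comment> \<open>Collects the parts of the drift proportional to \<open>\<mu>\<close>:
    \<open>C1 * M\<close> from the size of \<open>u0\<close> in the remainder,
    \<open>C\<beta>\<close> from \<open>\<beta>\<close>. The summand 1 makes the final drift
    inequality strict.\<close>
  define C where "C = C1 * M + C\<beta> + 1"
  have C: "C > 0" using C1 M C\<beta> by (simp add: C_def add_nonneg_pos)

  \<comment> \<open>Choice of the time \<open>\<sigma>\<close>\<close>
  have \<mu>_lim: "(\<mu> \<longlongrightarrow> 0) (at_right 0)" and \<phi>_lim: "(?\<phi> \<longlongrightarrow> 0) (at_right 0)"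
    using weight_tendsto_0[OF \<mu> T0] weight_primitive_tendsto_0[OF \<mu> T0] by auto
  have "\<forall>\<^sub>F t in at_right 0. t \<in> {0<..<min T Ts}"
    using \<open>T > 0\<close> \<open>Ts > 0\<close> by (intro eventually_at_right_real) auto
  moreover have "\<forall>\<^sub>F t in at_right 0. \<mu> t < min 1 (min (k0 / M) (\<nu>0\<^sup>2 / 2 / M))"
    using k0 \<nu>0 M by (intro order_tendstoD(2)[OF \<mu>_lim]) auto
  moreover have "\<forall>\<^sub>F t in at_right 0. ?\<phi> t < min (\<Theta> / 8 / C) (\<theta>s / 2 * rs)"
    using \<eta> C \<open>\<theta>s > 0\<close> \<open>rs > 0\<close> by (intro order_tendstoD(2)[OF \<phi>_lim]) auto
  moreover have "\<forall>\<^sub>F t in at_right 0. \<forall>x\<in>ball 0 (R0 / 4). norm (c t x - c 0 0) \<le> Kc * norm x + \<gamma> * \<Theta> / 8"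
    using \<gamma> \<eta> by (intro Kc) auto
  moreover have "\<forall>\<^sub>F t in at_right 0. \<forall>x\<in>ball 0 (R0 / 4). norm (lam t x - lam 0 0) \<le> Kl * norm x + a0 / 2"
    using a0 by (intro Kl) auto
  ultimately have "\<forall>\<^sub>F t in at_right 0. t \<in> {0<..<min T Ts} \<and> \<mu> t < min 1 (min (k0 / M) (\<nu>0\<^sup>2 / 2 / M)) \<and>
      ?\<phi> t < min (\<Theta> / 8 / C) (\<theta>s / 2 * rs) \<and>
      (\<forall>x\<in>ball 0 (R0 / 4). norm (c t x - c 0 0) \<le> Kc * norm x + \<gamma> * \<Theta> / 8) \<and>
      (\<forall>x\<in>ball 0 (R0 / 4). norm (lam t x - lam 0 0) \<le> Kl * norm x + a0 / 2) \<and>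
      (\<forall>x\<in>ball 0 R0. norm (\<beta> t x) \<le> C\<beta> * \<bar>\<mu> t\<bar>) \<and>
      (\<forall>x\<in>sector \<Theta> (\<eta> * R). norm (u t x) \<le> (e1\<^sup>2 / 2) * \<eta>\<^sup>2)"
    using C\<beta>(2) u_small unfolding \<Theta>_def by eventually_elim blast
  then obtain \<sigma> where \<sigma>: "\<sigma> > 0" and small: "\<And>t. 0 < t \<Longrightarrow> t < \<sigma> \<Longrightarrow>
      t \<in> {0<..<min T Ts} \<and> \<mu> t < min 1 (min (k0 / M) (\<nu>0\<^sup>2 / 2 / M)) \<and>
      ?\<phi> t < min (\<Theta> / 8 / C) (\<theta>s / 2 * rs) \<and>
      (\<forall>x\<in>ball 0 (R0 / 4). norm (c t x - c 0 0) \<le> Kc * norm x + \<gamma> * \<Theta> / 8) \<and>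
      (\<forall>x\<in>ball 0 (R0 / 4). norm (lam t x - lam 0 0) \<le> Kl * norm x + a0 / 2) \<and>
      (\<forall>x\<in>ball 0 R0. norm (\<beta> t x) \<le> C\<beta> * \<bar>\<mu> t\<bar>) \<and>
      (\<forall>x\<in>sector \<Theta> (\<eta> * R). norm (u t x) \<le> (e1\<^sup>2 / 2) * \<eta>\<^sup>2)"
    unfolding eventually_at_right_field by auto
  have t_range: "t < T" "t < Ts" "t < T0" if "0 < t" "t < \<sigma>" for t
    using small[OF that] \<open>Ts \<le> T0\<close> by auto
  have \<mu>_small: "0 < \<mu> t" "\<mu> t \<le> 1" "M * \<mu> t \<le> k0" "M * \<mu> t \<le> \<nu>0\<^sup>2 / 2" if "0 < t" "t < \<sigma>" for t
  proof -
    show "0 < \<mu> t" using \<mu> t_range[OF that] that by (simp add: weight_function_def)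
    show "\<mu> t \<le> 1" using small[OF that] by simp
    have "\<mu> t < k0 / M" "\<mu> t < \<nu>0\<^sup>2 / 2 / M" using small[OF that] by simp_all
    then have "\<mu> t * M < k0" "\<mu> t * M < \<nu>0\<^sup>2 / 2" using M(1) by (simp_all only: pos_less_divide_eq)
    then show "M * \<mu> t \<le> k0" "M * \<mu> t \<le> \<nu>0\<^sup>2 / 2" by (simp_all add: mult.commute)
  qed
  have \<phi>_small: "0 \<le> ?\<phi> t" "C * ?\<phi> t \<le> \<Theta> / 8" "?\<phi> t / rs < \<theta>s / 2" if "0 < t" "t < \<sigma>" for t
  proof -
    show "0 \<le> ?\<phi> t" using weight_primitive_nonneg[OF \<mu>, of t] t_range[OF that] that by simp
    have "?\<phi> t < \<Theta> / 8 / C" "?\<phi> t < \<theta>s / 2 * rs" using small[OF that] by simp_all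
    then have "?\<phi> t * C < \<Theta> / 8" "?\<phi> t / rs < \<theta>s / 2"
      using pos_less_divide_eq[OF C] pos_divide_less_eq[OF \<open>rs > 0\<close>] by blast+
    then show "C * ?\<phi> t \<le> \<Theta> / 8" "?\<phi> t / rs < \<theta>s / 2" by (simp_all add: mult.commute)
  qed
  have dom: "(t, x) \<in> {0<..<T} \<times> sector \<theta> R" "(t, x) \<in> ?W" "x \<in> sector \<Theta> (\<eta> * R)"
    if t: "0 < t" "t < \<sigma>" and x: "x \<in> sector \<Theta> (exp L)" for t x
  proof -
    have xx: "0 < norm x" "norm x < \<eta> * R'" "\<bar>Arg x\<bar> < \<Theta>" using x by (auto simp: sector_def expL)
    have "\<eta> * R' \<le> \<eta> * R" "\<eta> * R \<le> R" using R' \<eta> \<open>R > 0\<close> by (auto simp: mult_le_cancel_right1)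
    moreover have "\<Theta> \<le> \<theta>" using \<eta> \<open>\<theta> > 0\<close> by (simp add: \<Theta>_def mult_le_cancel_right1)
    ultimately show "(t, x) \<in> {0<..<T} \<times> sector \<theta> R" "x \<in> sector \<Theta> (\<eta> * R)"
      using xx t t_range[OF t] by (auto simp: sector_def)
    have "norm x < Rs * exp (- \<theta>s / 2)" using xx(2) expL expL_le R'(5) by linarith
    then have "exp (\<theta>s / 2) < Rs / norm x"
      using xx(1) by (simp add: exp_minus field_simps)
    then have "\<theta>s / 2 < ln (Rs / norm x)"
      using xx(1) \<open>Rs > 0\<close> by (subst exp_less_cancel_iff[symmetric]) simp
    moreover have "\<theta>s / 2 < \<theta>s - \<bar>Arg x\<bar>" using xx \<eta> by linarith
    ultimately have "\<theta>s / 2 < sector_dist \<theta>s Rs x" by (simp add: sector_dist_def)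
    then have "?\<phi> t / rs < sector_dist \<theta>s Rs x" using \<phi>_small(3)[OF t] by linarith
    moreover have "norm x < Rs"
    proof -
      have "Rs * exp (- \<theta>s / 2) \<le> Rs * 1"
        using \<open>Rs > 0\<close> \<open>\<theta>s > 0\<close> by (intro mult_left_mono) auto
      then show ?thesis using \<open>norm x < Rs * exp (- \<theta>s / 2)\<close> by linarith
    qed
    moreover have "\<bar>Arg x\<bar> < \<theta>s" using xx \<eta> \<open>\<theta>s > 0\<close> by linarith
    ultimately show "(t, x) \<in> ?W"
      using xx t t_range[OF t] by (simp add: W_domain_def sector_def)
  qed

  \<comment> \<open>The difference of the solutions in logarithmic coordinates\<close>
  define \<tau>m where "\<tau>m = ln \<sigma>"
  have \<tau>: "0 < exp \<tau>" "exp \<tau> < \<sigma>" if "\<tau> < \<tau>m" for \<tau> :: real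
    using that \<sigma> by (auto simp: \<tau>m_def) (metis exp_less_cancel_iff exp_ln)
  define S where "S = {y. Re y < L \<and> \<bar>Im y\<bar> < \<Theta>}"
  have \<Theta>_pi: "\<Theta> \<le> pi" using \<eta> pi_gt3 by simp
  have in_sector: "exp y \<in> sector \<Theta> (exp L)" if "y \<in> S" for y
    using that \<Theta>_pi by (auto simp: S_def intro: exp_in_sector)
  define W where "W = (\<lambda>\<tau> y. u (exp \<tau>) (exp y) - u0 (exp \<tau>) (exp y))"
  have dom_exp: "exp ` {..<\<tau>m} \<times> sector \<Theta> (exp L) \<subseteq> {0<..<T} \<times> sector \<theta> R"
      "exp ` {..<\<tau>m} \<times> sector \<Theta> (exp L) \<subseteq> ?W"
  proof -
    have "(exp \<tau>, x) \<in> {0<..<T} \<times> sector \<theta> R \<and> (exp \<tau>, x) \<in> ?W" if "\<tau> < \<tau>m" "x \<in> sector \<Theta> (exp L)" for \<tau> x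
      using dom(1,2)[OF \<tau>[OF that(1)] that(2)] by blast
    then show "exp ` {..<\<tau>m} \<times> sector \<Theta> (exp L) \<subseteq> {0<..<T} \<times> sector \<theta> R"
      "exp ` {..<\<tau>m} \<times> sector \<Theta> (exp L) \<subseteq> ?W" by blast+
  qed
  note log_u = log_coordinates[OF assms(26) \<Theta>_pi dom_exp(1), folded S_def]
  note log_u0 = log_coordinates[OF u0(1) \<Theta>_pi dom_exp(2), folded S_def]
  have W_deriv: "deriv (W \<tau>) y = exp y * deriv (u (exp \<tau>)) (exp y) - exp y * deriv (u0 (exp \<tau>)) (exp y)"
    if "\<tau> < \<tau>m" "y \<in> S" for \<tau> y
    unfolding W_def using log_u(3)[OF that] log_u0(3)[OF that] by (intro DERIV_imp_deriv DERIV_diff) auto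
  \<comment> \<open>Since \<open>t = exp \<tau>\<close>, the chain rule cancels the denominator in
    \<open>\<mu> t / t\<close>, so \<open>G'\<close> is the derivative of \<open>G\<close>.
    Integrability of the weight is what keeps \<open>G\<close> small.\<close>
  define G G' where "G = (\<lambda>\<tau>. C * ?\<phi> (exp \<tau>))" and "G' = (\<lambda>\<tau>. C * \<mu> (exp \<tau>))"
  \<comment> \<open>The three summands bound \<open>\<beta>\<close> (as
    \<open>\<mu> \<le> 1\<close>), \<open>x ^ p * c\<close> (as \<open>norm x \<le> 1\<close>) and
    the coefficient \<open>B\<close> of the remainder.\<close>
  define bm where "bm = C\<beta> + 2 * \<gamma> + a0"

  \<comment> \<open>The transport equation and its drift\<close>
  have transport: "\<exists>A b. ((\<lambda>e. W (\<tau> - e) (y + of_real e * b)) has_vector_derivative (- A * W \<tau> y)) (at 0) \<and>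
       Re A \<le> - 2 * a0 \<and> norm b \<le> bm \<and> Re b < C1 * k + G' \<tau> \<and>
       (\<Theta> / 2 \<le> Im y \<longrightarrow> Im b < C1 * k + G' \<tau>) \<and> (\<Theta> / 2 \<le> - Im y \<longrightarrow> - Im b < C1 * k + G' \<tau>)"
    if ty: "\<tau> < \<tau>m" "y \<in> S" and k: "norm (W \<tau> y) + norm (deriv (W \<tau>) y) \<le> k" "k \<le> k0" for \<tau> y k
  proof -
    define t x where "t = exp \<tau>" and "x = exp y"
    have t: "0 < t" "t < \<sigma>" using \<tau>[OF ty(1)] by (auto simp: t_def)
    have x: "x \<in> sector \<Theta> (exp L)" using in_sector[OF ty(2)] by (simp add: x_def)
    have norm_x: "norm x < exp L" "norm x \<le> R'" "x \<in> ball 0 (R0 / 4)" "x \<in> ball 0 R0" "norm x \<le> R0 / 2" "norm x \<le> 1"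
      using x expL_le R' R0 by (auto simp: sector_def)
    define w v where "w = W \<tau> y" and "v = deriv (W \<tau>) y"
    define v1 v0 where "v1 = x * deriv (u t) x" and "v0 = x * deriv (u0 t) x"
    have wv: "w = u t x - u0 t x" "v = v1 - v0"
      unfolding w_def v_def W_deriv[OF ty] by (simp_all add: W_def v1_def v0_def t_def x_def)
    \<comment> \<open>A common bound for both solutions and their derivatives: \<open>k\<close>
      controls the differences and \<open>M * \<mu> t\<close> controls \<open>u0\<close>.\<close>
    define m where "m = k + M * \<mu> t"
    have m: "norm (u t x) \<le> m" "norm v1 \<le> m" "norm (u0 t x) \<le> m" "norm v0 \<le> m" "m \<le> 2 * k0"
    proof -
      have b0: "norm (u0 t x) \<le> M * \<mu> t" "norm v0 \<le> M * \<mu> t"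
        using M(2,3)[OF dom(2)[OF t x]] by (simp_all add: v0_def)
      have sums: "w + u0 t x = u t x" "v + v0 = v1" by (simp_all add: wv)
      have "norm w + norm v \<le> k" using k(1) by (simp add: w_def v_def)
      then show "norm (u t x) \<le> m" "norm v1 \<le> m" "norm (u0 t x) \<le> m" "norm v0 \<le> m"
        using b0 norm_triangle_ineq[of w "u0 t x"] norm_triangle_ineq[of v v0] norm_ge_zero[of w] norm_ge_zero[of v]
        unfolding m_def sums by linarith+
      show "m \<le> 2 * k0" using \<mu>_small(3)[OF t] k(2) by (simp add: m_def)
    qed
    have "norm (R2 t x (u t x) v1 - R2 t x (u0 t x) v0) \<le> C1 * m * (norm w + norm v)"
      unfolding wv using m k0 t t_range[OF t] norm_x by (intro R2_lip) auto
    moreover have m0: "0 \<le> m" using m(1) norm_ge_zero[of "u t x"] by linarith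
    ultimately obtain A B where AB: "R2 t x (u t x) v1 - R2 t x (u0 t x) v0 = A * w + B * v"
        "norm A \<le> C1 * m" "norm B \<le> C1 * m"
      using split_coefficients[of _ "C1 * m" w v] C1 by (metis mult_nonneg_nonneg)
    have C1m: "C1 * m \<le> a0" using mult_left_mono[OF m(5) C1] C1k0 by linarith
    \<comment> \<open>All coefficients of \<open>v\<close> go into the direction \<open>b\<close>,
      so along \<open>(- 1, b)\<close> the derivative terms cancel and only a multiple of
      \<open>w\<close> remains.\<close>
    define b where "b = \<beta> t x + x ^ p * c t x + B"
    define D1 D0 where "D1 = vector_derivative (\<lambda>s. u s x) (at t)" and "D0 = vector_derivative (\<lambda>s. u0 s x) (at t)"
    have "of_real t * D1 = \<alpha> t x + lam t x * u t x + (\<beta> t x + x ^ p * c t x) * v1 + R2 t x (u t x) v1"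
      using assms(27) dom(1)[OF t x] unfolding solves_E_def D1_def v1_def by fast
    moreover have "of_real t * D0 = \<alpha> t x + lam t x * u0 t x + (\<beta> t x + x ^ p * c t x) * v0 + R2 t x (u0 t x) v0"
      using u0(2) dom(2)[OF t x] unfolding solves_E_def D0_def v0_def by fast
    ultimately have "of_real t * D1 - of_real t * D0 = lam t x * (u t x - u0 t x) + (\<beta> t x + x ^ p * c t x) * (v1 - v0)
        + (R2 t x (u t x) v1 - R2 t x (u0 t x) v0)"
      by (simp add: algebra_simps)
    then have eq: "of_real t * D1 - of_real t * D0 = (lam t x + A) * w + b * v"
      unfolding AB(1) wv[symmetric] b_def by (simp add: algebra_simps)
    have "((\<lambda>e. W (\<tau> - e) (y + of_real e * b)) has_vector_derivative
        (b * v1 - of_real t * D1) - (b * v0 - of_real t * D0)) (at 0)"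
      unfolding W_def using log_u(4)[OF ty, of b] log_u0(4)[OF ty, of b]
      by (intro has_vector_derivative_diff) (simp_all add: v1_def v0_def D1_def D0_def t_def x_def)
    moreover have "(b * v1 - of_real t * D1) - (b * v0 - of_real t * D0) = - (lam t x + A) * w"
    proof -
      have "(b * v1 - of_real t * D1) - (b * v0 - of_real t * D0) = b * (v1 - v0) - (of_real t * D1 - of_real t * D0)"
        by (simp add: algebra_simps)
      then show ?thesis unfolding eq wv(2)[symmetric] by (simp add: algebra_simps)
    qed
    ultimately have deriv: "((\<lambda>e. W (\<tau> - e) (y + of_real e * b)) has_vector_derivative (- (lam t x + A) * W \<tau> y)) (at 0)"
      by (simp add: w_def)
    have ReA: "Re (lam t x + A) \<le> - 2 * a0"
    proof -
      have "norm (lam t x - lam 0 0) \<le> Kl * norm x + a0 / 2" using small[OF t] norm_x by blast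
      moreover have "Kl * norm x \<le> Kl * R'" using norm_x Kl by (intro mult_left_mono) auto
      ultimately have "norm (lam t x - lam 0 0) \<le> a0" using KlR' by linarith
      then have "Re (lam t x) - Re (lam 0 0) \<le> a0" using complex_Re_le_cmod[of "lam t x - lam 0 0"] by simp
      moreover have "Re A \<le> a0" using complex_Re_le_cmod[of A] AB(2) C1m by linarith
      moreover have "Re (lam 0 0) = - 4 * a0" by (simp add: a0_def)
      ultimately show ?thesis by simp
    qed
    have c_near: "norm (c t x + of_real \<gamma>) \<le> \<gamma> * \<Theta> / 4"
    proof -
      have "norm (c t x - c 0 0) \<le> Kc * norm x + \<gamma> * \<Theta> / 8" using small[OF t] norm_x by blast
      moreover have "Kc * norm x \<le> Kc * (\<eta> * R')" using norm_x(1) Kc expL by (intro mult_left_mono) auto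
      moreover have "\<eta> * (Kc * R') \<le> \<eta> * (\<gamma> * \<theta> / 8)" using KcR' \<eta> by (intro mult_left_mono) auto
      ultimately show ?thesis by (simp add: \<gamma>(2) \<Theta>_def algebra_simps)
    qed
    have Im_y: "\<bar>Im y\<bar> \<le> \<Theta>" using ty(2) by (simp add: S_def)
    note drift = power_drift_inward[OF \<open>p \<ge> 1\<close> \<gamma>(1) \<eta>(3,4,5) Im_y c_near, folded x_def]
    have \<beta>: "norm (\<beta> t x) \<le> C\<beta> * \<mu> t"
      using small[OF t] norm_x(4) \<mu>_small(1)[OF t] by force
    have rest: "norm (\<beta> t x) + norm B < C1 * k + G' \<tau>"
    proof -
      have "C1 * m = C1 * k + C1 * M * \<mu> t" by (simp add: m_def algebra_simps)
      moreover have "G' \<tau> = C1 * M * \<mu> t + C\<beta> * \<mu> t + \<mu> t" by (simp add: G'_def C_def t_def algebra_simps)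
      ultimately show ?thesis using AB(3) \<beta> \<mu>_small(1)[OF t] by linarith
    qed
    have "norm b \<le> bm"
    proof -
      have "norm (c t x) \<le> norm (c t x + of_real \<gamma>) + norm (of_real \<gamma> :: complex)"
        using norm_triangle_ineq4[of "c t x + of_real \<gamma>" "of_real \<gamma>"] by simp
      moreover have "\<gamma> * \<Theta> \<le> \<gamma> * 1" using \<gamma> \<eta> by (intro mult_left_mono) auto
      moreover have "norm (of_real \<gamma> :: complex) = \<gamma>" using \<gamma> by simp
      ultimately have "norm (c t x) \<le> 2 * \<gamma>" using c_near \<gamma>(1) by linarith
      moreover have "norm (x ^ p) \<le> 1" using norm_x by (simp add: norm_power power_le_one)
      ultimately have "norm (x ^ p) * norm (c t x) \<le> 1 * (2 * \<gamma>)" by (intro mult_mono) auto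
      moreover have "C\<beta> * \<mu> t \<le> C\<beta> * 1" using C\<beta> \<mu>_small(2)[OF t] by (intro mult_left_mono) auto
      moreover have "norm b \<le> norm (\<beta> t x) + norm (x ^ p * c t x) + norm B"
        using norm_triangle_ineq[of "\<beta> t x + x ^ p * c t x" B] norm_triangle_ineq[of "\<beta> t x" "x ^ p * c t x"]
        unfolding b_def by linarith
      ultimately show ?thesis using AB(3) C1m \<beta> unfolding bm_def norm_mult by linarith
    qed
    moreover have "Re b < C1 * k + G' \<tau>"
      using rest drift(1) complex_Re_le_cmod[of "\<beta> t x"] complex_Re_le_cmod[of B] by (simp add: b_def)
    moreover have "Im b < C1 * k + G' \<tau>" if "\<Theta> / 2 \<le> Im y"
      using rest drift(2)[OF that] abs_Im_le_cmod[of "\<beta> t x"] abs_Im_le_cmod[of B] by (simp add: b_def)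
    moreover have "- Im b < C1 * k + G' \<tau>" if "\<Theta> / 2 \<le> - Im y"
      using rest drift(3)[OF that] abs_Im_le_cmod[of "\<beta> t x"] abs_Im_le_cmod[of B] by (simp add: b_def)
    ultimately show ?thesis using deriv ReA by blast
  qed

  \<comment> \<open>Vanishing of the difference on a half strip\<close>
  have vanish: "W \<tau> y = 0" if "\<tau> < \<tau>m" "Re y \<le> L - \<Theta> / 2" "\<bar>Im y\<bar> \<le> \<Theta> / 2" for \<tau> y
  proof (rule transport_vanishing[where W = W and G = G and G' = G' and L = L and \<Theta> = \<Theta> and ?a0.0 = a0
        and bm = bm and ?C1.0 = C1 and ?k0.0 = k0 and ?\<nu>0.0 = \<nu>0 and ?D0.0 = "\<Theta> / 8" and \<tau>m = \<tau>m,
        folded S_def q_def])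
    show "0 \<le> G \<tau>" if "\<tau> < \<tau>m" for \<tau>
      using \<phi>_small(1)[OF \<tau>[OF that]] C by (simp add: G_def)
    show "(G has_real_derivative G' \<tau>) (at \<tau>)" if "\<tau> < \<tau>m" for \<tau>
    proof -
      have "(?\<phi> has_real_derivative \<mu> (exp \<tau>) / exp \<tau>) (at (exp \<tau>))"
        using t_range(3)[OF \<tau>[OF that]] by (intro weight_primitive_deriv[OF \<mu>]) auto
      from DERIV_cmult[OF DERIV_chain2[OF this DERIV_exp]] show ?thesis
        by (simp add: G_def G'_def)
    qed
    \<comment> \<open>The initial margin, the geometric series and \<open>G\<close> each use at most
      \<open>\<Theta> / 8\<close>, within the available \<open>\<Theta> / 2\<close>.\<close>
    show "\<Theta> / 8 + (1 + 2 * C1) * \<nu>0 / (1 - q) + G \<tau> \<le> \<Theta> / 2" if "\<tau> < \<tau>m" for \<tau>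
    proof -
      have "\<eta> * ((1 + 2 * C1) * e1 / (1 - q)) \<le> \<eta> * (\<theta> / 8)"
        using e1' \<eta> by (intro mult_left_mono) auto
      then have "(1 + 2 * C1) * \<nu>0 / (1 - q) \<le> \<Theta> / 8"
        by (simp add: \<nu>0_def \<Theta>_def mult_ac)
      moreover have "G \<tau> \<le> \<Theta> / 8" using \<phi>_small(2)[OF \<tau>[OF that]] by (simp add: G_def)
      ultimately show ?thesis using \<eta>(3) by linarith
    qed
    show "continuous_on ({..<\<tau>m} \<times> S) (\<lambda>(\<tau>, y). W \<tau> y)"
      using continuous_on_diff[OF log_u(1) log_u0(1)] by (simp add: W_def case_prod_unfold)
    show "W \<tau> holomorphic_on S" if "\<tau> < \<tau>m" for \<tau>
      unfolding W_def using log_u(2)[OF that] log_u0(2)[OF that] by (intro holomorphic_on_diff) auto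
    show "norm (W \<tau> y) \<le> \<nu>0\<^sup>2" if "\<tau> < \<tau>m" "y \<in> S" for \<tau> y
    proof -
      note t = \<tau>[OF that(1)] and x = in_sector[OF that(2)]
      have "norm (u (exp \<tau>) (exp y)) \<le> \<nu>0\<^sup>2 / 2"
        using small[OF t] dom(3)[OF t x] by (auto simp: \<nu>0_def power_mult_distrib)
      moreover have "norm (u0 (exp \<tau>) (exp y)) \<le> \<nu>0\<^sup>2 / 2"
        using M(2)[OF dom(2)[OF t x]] \<mu>_small(4)[OF t] by linarith
      ultimately show ?thesis
        using norm_triangle_ineq4[of "u (exp \<tau>) (exp y)" "u0 (exp \<tau>) (exp y)"] unfolding W_def by linarith
    qed
    show "0 < bm" using C\<beta> \<gamma> a0 by (simp add: bm_def)
    show "2 * \<nu>0 \<le> k0" "\<nu>0 \<le> 1" using \<nu>0 e1 by linarith+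
  qed (use a0 C1 \<nu>0 \<eta> that transport in auto)

  \<comment> \<open>Return to the original variables\<close>
  define \<theta>1 R1 where "\<theta>1 = \<Theta> / 2" and "R1 = exp (L - \<Theta> / 2)"
  have R1: "R1 > 0" "R1 \<le> exp L" using \<eta> by (auto simp: R1_def)
  have sub: "x \<in> sector \<Theta> (exp L)" if "x \<in> sector \<theta>1 R1" for x
    using that R1 \<eta> by (auto simp: sector_def \<theta>1_def)
  have "u t x = u0 t x" if t: "t \<in> {0<..<\<sigma>}" and x: "x \<in> sector \<theta>1 R1" for t x
  proof -
    have x0: "x \<noteq> 0" using x by (auto simp: sector_def)
    have "ln (norm x) < L - \<Theta> / 2"
      using x by (subst exp_less_cancel_iff[symmetric]) (simp add: sector_def R1_def)
    then have "W (ln t) (Ln x) = 0"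
      using x t x0 \<sigma> by (intro vanish) (auto simp: \<tau>m_def sector_def \<theta>1_def Arg_eq_Im_Ln)
    then show ?thesis using t x0 by (simp add: W_def)
  qed
  moreover have "{0<..<\<sigma>} \<times> sector \<theta>1 R1 \<subseteq> ({0<..<T} \<times> sector \<theta> R) \<inter> ?W"
  proof -
    have "(t, x) \<in> ({0<..<T} \<times> sector \<theta> R) \<inter> ?W" if "0 < t" "t < \<sigma>" "x \<in> sector \<theta>1 R1" for t x
      using dom(1,2)[OF that(1,2) sub[OF that(3)]] by (rule IntI)
    then have "z \<in> ({0<..<T} \<times> sector \<theta> R) \<inter> ?W" if "z \<in> {0<..<\<sigma>} \<times> sector \<theta>1 R1" for z
      using that by (cases z) (metis greaterThanLessThan_iff mem_Sigma_iff)
    then show ?thesis by (rule subsetI)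
  qed
  moreover have "\<theta>1 > 0" using \<eta> by (simp add: \<theta>1_def)
  ultimately show ?thesis
    using \<sigma> R1(1) by blast
qed

end
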